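(* Let $k$ and $m$ be positive integers, $\Gamma$ a congruence subgroup of $\mathrm{SL}_2(\mathbb Z)$ and $\chi$ a character of $\Gamma$ of finite order. For every positive integer $N$ with $$N\ \ge\ \frac{k\,[\mathrm{SL}_2(\mathbb Z):\Gamma]}{4}\Big(2\pi^{2/3}m^{1/3}k^{-1/3}+13\Big)\cdot\log\log\Big(2\pi^{2/3}m^{1/3}k^{-1/3}+13\Big),$$ we have $J_{k,m}(\Gamma,\chi)[q^N]=0$.
   Context: $J_{k,m}(\Gamma,\chi)$ is the space of holomorphic classical Jacobi forms of weight $k$, index $m$ and character $\chi$ on $\Gamma$: holomorphic $\varphi:\mathbb H\times\mathbb C\to\mathbb C$ with $(\varphi|_{k,m}A)=\chi(A)\varphi$ for $A\in\Gamma$, where $(\varphi|_{k,m}A)(\tau,z)=(c\tau+d)^{-k}e^{-2\pi i m\frac{cz^2}{c\tau+d}}\varphi\big(\frac{a\tau+b}{c\tau+d},\frac{z}{c\tau+d}\big)$ for $A=\begin{pmatrix}a&b\\c&d\end{pmatrix}$; $e^{2\pi i m(\lambda^2\tau+2\lambda z)}\varphi(\tau,z+\lambda\tau+\mu)=\varphi(\tau,z)$ for $\lambda,\mu\in\mathbb Z$; and for every $\gamma\in\mathrm{SL}_2(\mathbb Z)$, $\varphi|_{k,m}\gamma=\sum f_\gamma(n,r)q^n\zeta^r$ ($q=e^{2\pi i\tau}$, $\zeta=e^{2\pi iz}$, $r\in\mathbb Z$, $n\ge0$ rational with bounded denominators) with $f_\gamma(n,r)=0$ unless $4nm\ge r^2$.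 Writing $\varphi=\sum_nc_n(z)q^n$, $\mathrm{ord}_\infty(\varphi)$ is the least $n$ with $c_n\not\equiv0$ ($\infty$ if $\varphi=0$), and $J_{k,m}(\Gamma,\chi)[q^N]=\{\varphi\in J_{k,m}(\Gamma,\chi):\mathrm{ord}_\infty(\varphi)\ge N\}$. *)

theory Defs
  imports "HOL-Analysis.Analysis" "HOL-Algebra.Coset"
begin

definition SL2Z :: "(int^2^2) monoid" where
  "SL2Z = \<lparr>carrier = {A. det A = 1}, monoid.mult = (**), one = mat 1\<rparr>"

definition principal_congruence_subgroup :: "nat \<Rightarrow> (int^2^2) set" where
  "principal_congruence_subgroup N =
     {A \<in> carrier SL2Z. \<forall>i j. A $ i $ j mod int N = (mat 1 :: int^2^2) $ i $ j mod int N}"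

definition congruence_subgroup :: "(int^2^2) set \<Rightarrow> bool" where
  "congruence_subgroup \<Gamma> \<longleftrightarrow>
     subgroup \<Gamma> SL2Z \<and> (\<exists>N>0. principal_congruence_subgroup N \<subseteq> \<Gamma>)"

definition SL2Z_index :: "(int^2^2) set \<Rightarrow> nat" where
  "SL2Z_index \<Gamma> = card (rcosets\<^bsub>SL2Z\<^esub> \<Gamma>)"

definition nonzero_complex_group :: "complex monoid" where
  "nonzero_complex_group = \<lparr>carrier = - {0}, monoid.mult = (*), one = 1\<rparr>"

text \<open>Values of the character outside \<open>\<Gamma>\<close> are irrelevant.\<close>

definition finite_order_character :: "(int^2^2) set \<Rightarrow> (int^2^2 \<Rightarrow> complex) \<Rightarrow> bool" where
  "finite_order_character \<Gamma> chi \<longleftrightarrow>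
     chi \<in> hom (SL2Z\<lparr>carrier := \<Gamma>\<rparr>) nonzero_complex_group \<and>
     (\<exists>n::nat. n > 0 \<and> (\<forall>A\<in>\<Gamma>. chi A ^ n = 1))"

text \<open>Joint holomorphy in two variables: the real total derivative exists and is complex linear.
  This is meant for open \<open>S\<close>.\<close>

definition holomorphic2_on :: "(complex \<times> complex \<Rightarrow> complex) \<Rightarrow> (complex \<times> complex) set \<Rightarrow> bool" where
  "holomorphic2_on f S \<longleftrightarrow>
     (\<forall>p\<in>S. \<exists>f'. (f has_derivative f') (at p) \<and>
                   (\<forall>c u v. f' (c * u, c * v) = c * f' (u, v)))"

definition jacobi_slash ::
  "nat \<Rightarrow> nat \<Rightarrow> (complex \<Rightarrow> complex \<Rightarrow> complex) \<Rightarrow> int^2^2 \<Rightarrow> complex \<Rightarrow> complex \<Rightarrow> complex" where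
  "jacobi_slash k m \<phi> A \<tau> z =
     (let a = of_int (A $ 1 $ 1); b = of_int (A $ 1 $ 2);
          c = of_int (A $ 2 $ 1); d = of_int (A $ 2 $ 2)
      in (c * \<tau> + d) powi (- int k)
         * exp (- 2 * of_real pi * \<i> * of_nat m * (c * z\<^sup>2 / (c * \<tau> + d)))
         * \<phi> ((a * \<tau> + b) / (c * \<tau> + d)) (z / (c * \<tau> + d)))"

definition nonneg_rats_denom :: "nat \<Rightarrow> rat set" where
  "nonneg_rats_denom M = {of_nat j / of_nat M | j :: nat. True}"

text \<open>For rational \<open>n\<close>, the power \<open>q\<^sup>n\<close> means \<open>exp (2\<pi>i n\<tau>)\<close>. The double series is summed
  unconditionally, i.e. absolutely.\<close>

definition jacobi_fourier_expansion ::
  "nat \<Rightarrow> (complex \<Rightarrow> complex \<Rightarrow> complex) \<Rightarrow> nat \<Rightarrow> (rat \<Rightarrow> int \<Rightarrow> complex) \<Rightarrow> bool" where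
  "jacobi_fourier_expansion m \<psi> M f \<longleftrightarrow>
     (\<forall>\<tau> z. Im \<tau> > 0 \<longrightarrow>
        ((\<lambda>(n, r). f n r * exp (2 * of_real pi * \<i> * of_rat n * \<tau>)
                          * exp (2 * of_real pi * \<i> * of_int r * z))
          has_sum \<psi> \<tau> z) (nonneg_rats_denom M \<times> UNIV)) \<and>
     (\<forall>n\<in>nonneg_rats_denom M. \<forall>r. f n r \<noteq> 0 \<longrightarrow> 4 * n * of_nat m \<ge> (of_int r)\<^sup>2)"

text \<open>Functions on the upper half plane times \<open>\<complex>\<close> are represented by total functions that
  vanish for \<open>Im \<tau> \<le> 0\<close>, so that equality of forms is equality in HOL.\<close>

definition jacobi_forms ::
  "nat \<Rightarrow> nat \<Rightarrow> (int^2^2) set \<Rightarrow> (int^2^2 \<Rightarrow> complex) \<Rightarrow> (complex \<Rightarrow> complex \<Rightarrow> complex) set" where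
  "jacobi_forms k m \<Gamma> chi = {\<phi>.
     (\<forall>\<tau> z. Im \<tau> \<le> 0 \<longrightarrow> \<phi> \<tau> z = 0) \<and>
     holomorphic2_on (\<lambda>(\<tau>, z). \<phi> \<tau> z) ({\<tau>. Im \<tau> > 0} \<times> UNIV) \<and>
     (\<forall>A\<in>\<Gamma>. \<forall>\<tau> z. Im \<tau> > 0 \<longrightarrow> jacobi_slash k m \<phi> A \<tau> z = chi A * \<phi> \<tau> z) \<and>
     (\<forall>l u :: int. \<forall>\<tau> z. Im \<tau> > 0 \<longrightarrow>
        exp (2 * of_real pi * \<i> * of_nat m * ((of_int l)\<^sup>2 * \<tau> + 2 * of_int l * z))
          * \<phi> \<tau> (z + of_int l * \<tau> + of_int u) = \<phi> \<tau> z) \<and>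
     (\<forall>\<gamma>\<in>carrier SL2Z. \<exists>M>0. \<exists>f. jacobi_fourier_expansion m (jacobi_slash k m \<phi> \<gamma>) M f)}"

text \<open>\<open>\<phi> = (\<Sum>n. c n z q\<^sup>n)\<close> with exponents of bounded denominator. The coefficient functions
  \<open>c n\<close> are uniquely determined by \<open>\<phi>\<close>, since they vanish off the set of exponents.\<close>

definition q_expansion ::
  "(complex \<Rightarrow> complex \<Rightarrow> complex) \<Rightarrow> (rat \<Rightarrow> complex \<Rightarrow> complex) \<Rightarrow> bool" where
  "q_expansion \<phi> c \<longleftrightarrow> (\<exists>M>0.
     (\<forall>n z. n \<notin> nonneg_rats_denom M \<longrightarrow> c n z = 0) \<and>
     (\<forall>\<tau> z. Im \<tau> > 0 \<longrightarrow>
        ((\<lambda>n. c n z * exp (2 * of_real pi * \<i> * of_rat n * \<tau>)) has_sum \<phi> \<tau> z)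
          (nonneg_rats_denom M)))"

text \<open>The infimum is over a discrete set of nonnegative rationals, hence a minimum,
  or \<open>\<infinity>\<close> if the set is empty. Every Jacobi form has a q-expansion.\<close>

definition ord_infty :: "(complex \<Rightarrow> complex \<Rightarrow> complex) \<Rightarrow> ereal" where
  "ord_infty \<phi> = Inf {ereal (of_rat n) | n c. q_expansion \<phi> c \<and> (\<exists>z. c n z \<noteq> 0)}"

definition jacobi_forms_vanishing ::
  "nat \<Rightarrow> nat \<Rightarrow> (int^2^2) set \<Rightarrow> (int^2^2 \<Rightarrow> complex) \<Rightarrow> nat
     \<Rightarrow> (complex \<Rightarrow> complex \<Rightarrow> complex) set" where
  "jacobi_forms_vanishing k m \<Gamma> chi N = {\<phi> \<in> jacobi_forms k m \<Gamma> chi. ord_infty \<phi> \<ge> ereal (real N)}"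

end

theory Submission
  imports Defs "HOL-Complex_Analysis.Complex_Analysis" "HOL-Real_Asymp.Real_Asymp"
begin

text \<open>The function \<open>|\<phi>(\<tau>, \<lambda>\<tau> + \<mu>)| exp(-2\<pi>m\<lambda>\<^sup>2v) v\<^sup>k\<^sup>/\<^sup>2\<close>, \<open>v = Im \<tau>\<close>, transforms under \<open>SL\<^sub>2(\<int>)\<close>
  through the right action on the row vector \<open>(\<lambda>, \<mu>)\<close>, taken modulo 1. Hence the product of the
  functions \<open>e(m\<lambda>\<^sup>2\<tau>) (\<phi>|A)(\<tau>, \<lambda>\<tau> + \<mu>)\<close> over all \<open>q\<close>-torsion points \<open>(\<lambda>, \<mu>) \<noteq> 0\<close>, for a prime \<open>q\<close>,
  and over all cosets \<open>\<Gamma>A\<close> behaves in absolute value like a modular form of level one and weight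
  \<open>W = k [SL\<^sub>2(\<int>) : \<Gamma>] (q\<^sup>2 - 1)\<close>; for large \<open>q\<close> it is not identically zero unless \<open>\<phi> = 0\<close>.
  Since \<open>4nm \<ge> r\<^sup>2\<close>, every factor has nonnegative order at infinity, and the factors of the trivial
  coset with \<open>0 \<le> \<lambda> \<le> \<delta>\<close>, a proportion of about \<open>\<delta>\<close>, have order at least \<open>(\<surd>N - \<delta>\<surd>m)\<^sup>2\<close>. A form
  of weight \<open>W\<close> whose order at infinity exceeds \<open>W / (2\<pi>\<surd>3)\<close> vanishes by the maximum principle,
  which forces \<open>\<phi> = 0\<close> once \<open>\<delta>\<close> is chosen as \<open>1/2\<close> or \<open>\<surd>(N/m)/3\<close>.\<close>

section \<open>The action of SL(2,Z) on the upper half-plane\<close>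

abbreviation upper_half_plane :: "complex set" where
  "upper_half_plane \<equiv> {\<tau>. 0 < Im \<tau>}"

definition mat2 :: "int \<Rightarrow> int \<Rightarrow> int \<Rightarrow> int \<Rightarrow> int^2^2" where
  "mat2 a b c d = vector [vector [a, b], vector [c, d]]"

lemma mat2_nth [simp]:
  "mat2 a b c d $ 1 $ 1 = a" "mat2 a b c d $ 1 $ 2 = b"
  "mat2 a b c d $ 2 $ 1 = c" "mat2 a b c d $ 2 $ 2 = d"
  by (simp_all add: mat2_def)

lemma mat2_eqI:
  fixes A B :: "int^2^2"
  assumes "A$1$1 = B$1$1" "A$1$2 = B$1$2" "A$2$1 = B$2$1" "A$2$2 = B$2$2"
  shows "A = B"
  using assms by (simp add: vec_eq_iff forall_2)

lemma mat2_mult_nth: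
  fixes A B :: "int^2^2"
  shows "(A ** B) $ i $ j = A$i$1 * B$1$j + A$i$2 * B$2$j"
  by (simp add: matrix_matrix_mult_def sum_2)

lemma mat_one_nth: "(mat 1 :: int^2^2) $ 1 $ 1 = 1" "(mat 1 :: int^2^2) $ 1 $ 2 = 0"
  "(mat 1 :: int^2^2) $ 2 $ 1 = 0" "(mat 1 :: int^2^2) $ 2 $ 2 = 1"
  by (simp_all add: mat_def)

lemma SL2Z_carrier_iff: "A \<in> carrier SL2Z \<longleftrightarrow> A$1$1 * A$2$2 - A$1$2 * A$2$1 = 1"
  by (simp add: SL2Z_def det_2)

lemma SL2Z_simps [simp]: "A \<otimes>\<^bsub>SL2Z\<^esub> B = A ** B" "\<one>\<^bsub>SL2Z\<^esub> = mat 1"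
  by (simp_all add: SL2Z_def)

definition adj2 :: "int^2^2 \<Rightarrow> int^2^2" where
  "adj2 A = mat2 (A$2$2) (- A$1$2) (- A$2$1) (A$1$1)"

lemma adj2_in_SL2Z: "A \<in> carrier SL2Z \<Longrightarrow> adj2 A \<in> carrier SL2Z"
  by (simp add: SL2Z_carrier_iff adj2_def algebra_simps)

lemma adj2_mult:
  assumes "A \<in> carrier SL2Z"
  shows "adj2 A ** A = mat 1" "A ** adj2 A = mat 1"
  using assms
  by (auto intro!: mat2_eqI simp: SL2Z_carrier_iff mat2_mult_nth adj2_def mat_one_nth algebra_simps)

lemma group_SL2Z: "group SL2Z"
proof (rule groupI)
  fix A B assume "A \<in> carrier SL2Z" "B \<in> carrier SL2Z"
  then show "A \<otimes>\<^bsub>SL2Z\<^esub> B \<in> carrier SL2Z"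
    by (simp add: SL2Z_def det_mul)
next
  fix A assume "A \<in> carrier SL2Z"
  then show "\<exists>B\<in>carrier SL2Z. B \<otimes>\<^bsub>SL2Z\<^esub> A = \<one>\<^bsub>SL2Z\<^esub>"
    using adj2_in_SL2Z adj2_mult by auto
qed (auto simp: SL2Z_carrier_iff mat_one_nth matrix_mul_assoc)

interpretation SL2Z: group SL2Z by (rule group_SL2Z)

section \<open>Moebius maps and reduced points\<close>

definition moebius_denom :: "int^2^2 \<Rightarrow> complex \<Rightarrow> complex" where
  "moebius_denom A \<tau> = of_int (A$2$1) * \<tau> + of_int (A$2$2)"

definition moebius_int :: "int^2^2 \<Rightarrow> complex \<Rightarrow> complex" where
  "moebius_int A \<tau> = (of_int (A$1$1) * \<tau> + of_int (A$1$2)) / moebius_denom A \<tau>"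

lemma linear_form_nonzero:
  assumes "Im \<tau> > 0" "(c, d) \<noteq> (0, 0)"
  shows "of_int c * \<tau> + of_int d \<noteq> 0"
proof
  assume "of_int c * \<tau> + of_int d = 0"
  then have "Im (of_int c * \<tau> + of_int d) = 0" "Re (of_int c * \<tau> + of_int d) = 0" by simp_all
  with assms show False by auto
qed

lemma moebius_denom_nonzero:
  assumes "A \<in> carrier SL2Z" "Im \<tau> > 0"
  shows "moebius_denom A \<tau> \<noteq> 0"
proof -
  have "(A$2$1, A$2$2) \<noteq> (0, 0)"
    using assms(1) by (auto simp: SL2Z_carrier_iff)
  with assms(2) show ?thesis
    unfolding moebius_denom_def by (intro linear_form_nonzero)
qed

lemma Im_moebius_int:
  assumes "A \<in> carrier SL2Z" "Im \<tau> > 0"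
  shows "Im (moebius_int A \<tau>) = Im \<tau> / (cmod (moebius_denom A \<tau>))\<^sup>2"
proof -
  define a b c d where "a = real_of_int (A$1$1)" and "b = real_of_int (A$1$2)"
    and "c = real_of_int (A$2$1)" and "d = real_of_int (A$2$2)"
  have det: "a * d - b * c = 1"
    using arg_cong[OF assms(1)[unfolded SL2Z_carrier_iff], of real_of_int]
    by (simp add: a_def b_def c_def d_def)
  obtain x y where \<tau>: "\<tau> = Complex x y" by (cases \<tau>)
  have "Im (moebius_int A \<tau>) = (a * y * (c * x + d) - (a * x + b) * (c * y)) / ((c * x + d)\<^sup>2 + (c * y)\<^sup>2)"
    by (simp add: moebius_int_def moebius_denom_def \<tau> Im_divide a_def b_def c_def d_def)
  also have "a * y * (c * x + d) - (a * x + b) * (c * y) = y * (a * d - b * c)"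
    by algebra
  also have "(c * x + d)\<^sup>2 + (c * y)\<^sup>2 = (cmod (moebius_denom A \<tau>))\<^sup>2"
    by (simp add: cmod_power2 moebius_denom_def \<tau> c_def d_def)
  finally show ?thesis by (simp add: det \<tau>)
qed

lemma Im_moebius_int_pos:
  assumes "A \<in> carrier SL2Z" "Im \<tau> > 0"
  shows "Im (moebius_int A \<tau>) > 0"
  using assms moebius_denom_nonzero[OF assms] by (simp add: Im_moebius_int)

lemma moebius_denom_mult:
  assumes "B \<in> carrier SL2Z" "Im \<tau> > 0"
  shows "moebius_denom (A ** B) \<tau> = moebius_denom A (moebius_int B \<tau>) * moebius_denom B \<tau>"
proof -
  have "moebius_denom A (moebius_int B \<tau>) * moebius_denom B \<tau>
      = of_int (A$2$1) * (of_int (B$1$1) * \<tau> + of_int (B$1$2)) + of_int (A$2$2) * moebius_denom B \<tau>"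
  proof -
    have "moebius_int B \<tau> * moebius_denom B \<tau> = of_int (B$1$1) * \<tau> + of_int (B$1$2)"
      using moebius_denom_nonzero[OF assms] by (simp add: moebius_int_def)
    then show ?thesis
      by (simp only: moebius_denom_def[of A] distrib_right mult.assoc)
  qed
  also have "\<dots> = moebius_denom (A ** B) \<tau>"
    by (simp add: moebius_denom_def mat2_mult_nth algebra_simps)
  finally show ?thesis by simp
qed

lemma moebius_int_mult:
  assumes "A \<in> carrier SL2Z" "B \<in> carrier SL2Z" "Im \<tau> > 0"
  shows "moebius_int (A ** B) \<tau> = moebius_int A (moebius_int B \<tau>)"
proof -
  have nz: "moebius_denom B \<tau> \<noteq> 0" "moebius_denom A (moebius_int B \<tau>) \<noteq> 0"
    using assms moebius_denom_nonzero Im_moebius_int_pos by auto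
  have "of_int ((A ** B)$1$1) * \<tau> + of_int ((A ** B)$1$2)
      = (of_int (A$1$1) * moebius_int B \<tau> + of_int (A$1$2)) * moebius_denom B \<tau>"
    using nz(1) by (simp add: moebius_int_def field_simps)
      (simp add: moebius_denom_def mat2_mult_nth algebra_simps)
  then show ?thesis
    using nz moebius_denom_mult[OF assms(2,3), of A] by (simp add: moebius_int_def[of "A ** B"] moebius_int_def[of A])
qed

text \<open>The imaginary part of \<open>c\<tau> + d\<close> bounds c, and then its real part bounds
  d. This lets a minimum over bottom rows be taken.\<close>

lemma finite_small_linear_forms:
  assumes "Im \<tau> > 0"
  shows "finite {(c, d). cmod (of_int c * \<tau> + of_int d) \<le> B}"
proof (cases "B \<ge> 0")
  case True
  define K where "K = \<lceil>B / Im \<tau>\<rceil>"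
  define L where "L = \<lceil>B + of_int K * \<bar>Re \<tau>\<bar>\<rceil>"
  have "{(c, d). cmod (of_int c * \<tau> + of_int d) \<le> B} \<subseteq> {-K..K} \<times> {-L..L}"
  proof
    fix p assume "p \<in> {(c, d). cmod (of_int c * \<tau> + of_int d) \<le> B}"
    then obtain c d where p: "p = (c, d)" and *: "cmod (of_int c * \<tau> + of_int d) \<le> B" by auto
    have "\<bar>of_int c * Im \<tau>\<bar> \<le> B"
      using abs_Im_le_cmod[of "of_int c * \<tau> + of_int d"] * by simp
    then have "\<bar>of_int c\<bar> \<le> B / Im \<tau>"
      using assms by (simp add: abs_mult field_simps)
    then have c: "\<bar>c\<bar> \<le> K" unfolding K_def by linarith
    have "\<bar>of_int c * Re \<tau> + of_int d\<bar> \<le> B"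
      using abs_Re_le_cmod[of "of_int c * \<tau> + of_int d"] * by simp
    moreover have "\<bar>of_int c * Re \<tau>\<bar> \<le> of_int K * \<bar>Re \<tau>\<bar>"
    proof -
      have "real_of_int \<bar>c\<bar> \<le> of_int K" using c by (simp only: of_int_le_iff)
      then show ?thesis by (simp add: abs_mult mult_right_mono)
    qed
    ultimately have "\<bar>of_int d\<bar> \<le> B + of_int K * \<bar>Re \<tau>\<bar>" by linarith
    then have "\<bar>d\<bar> \<le> L" unfolding L_def by linarith
    with c p show "p \<in> {-K..K} \<times> {-L..L}" by auto
  qed
  then show ?thesis by (rule finite_subset) auto
next
  case False
  then have "\<not> cmod z \<le> B" for z :: complex
    using norm_ge_zero[of z] by linarith
  then have "{(c, d). cmod (of_int c * \<tau> + of_int d) \<le> B} = {}"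
    by simp
  then show ?thesis by simp
qed

lemma translation_in_SL2Z: "mat2 1 n 0 1 \<in> carrier SL2Z"
  by (simp add: SL2Z_carrier_iff)

lemma moebius_int_translation [simp]: "moebius_int (mat2 1 n 0 1) \<tau> = \<tau> + of_int n"
  by (simp add: moebius_int_def moebius_denom_def)

text \<open>The representative is found by minimising \<open>\<bar>c\<tau> + d\<bar>\<close> over the bottom rows.\<close>

lemma exists_moebius_reduced:
  assumes \<tau>: "Im \<tau> > 0"
  obtains A where "A \<in> carrier SL2Z" "\<bar>Re (moebius_int A \<tau>)\<bar> \<le> 1 / 2"
    "Im (moebius_int A \<tau>) \<ge> sqrt 3 / 2"
proof -
  \<comment> \<open>Cutting off at 1, the value at the identity matrix, leaves a finite nonempty set
    whose minimum is the minimum over all of SL(2,Z).\<close>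
  define S where "S = (\<lambda>A. cmod (moebius_denom A \<tau>)) ` {A \<in> carrier SL2Z. cmod (moebius_denom A \<tau>) \<le> 1}"
  have one: "mat 1 \<in> carrier SL2Z" using SL2Z.one_closed by simp
  have "moebius_denom (mat 1) \<tau> = 1" by (simp add: moebius_denom_def mat_one_nth)
  then have S1: "1 \<in> S" unfolding S_def using one by force
  have "S \<subseteq> (\<lambda>(c, d). cmod (of_int c * \<tau> + of_int d)) ` {(c, d). cmod (of_int c * \<tau> + of_int d) \<le> 1}"
    unfolding S_def moebius_denom_def by force
  then have "finite S"
    using finite_small_linear_forms[OF \<tau>] finite_surj by blast
  define A where "A = (SOME A. A \<in> carrier SL2Z \<and> cmod (moebius_denom A \<tau>) = Min S)"
  have "Min S \<in> S" using \<open>finite S\<close> S1 by (intro Min_in) auto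
  then have "\<exists>A. A \<in> carrier SL2Z \<and> cmod (moebius_denom A \<tau>) = Min S"
    unfolding S_def by auto
  then have A: "A \<in> carrier SL2Z" "cmod (moebius_denom A \<tau>) = Min S"
    unfolding A_def by (metis (mono_tags, lifting) someI_ex)+
  have minA: "cmod (moebius_denom A \<tau>) \<le> cmod (moebius_denom B \<tau>)" if "B \<in> carrier SL2Z" for B
  proof (cases "cmod (moebius_denom B \<tau>) \<le> 1")
    case True
    then have "cmod (moebius_denom B \<tau>) \<in> S" using that by (auto simp: S_def)
    then show ?thesis using A(2) \<open>finite S\<close> by simp
  next
    case False
    have "Min S \<le> 1" using S1 \<open>finite S\<close> by simp
    then show ?thesis using A(2) False by simp
  qed
  \<comment> \<open>The image has height Im \<tau> divided by the squared modulus of the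
    denominator, so the least denominator gives a highest point of the orbit.\<close>
  have ImA: "Im (moebius_int B \<tau>) \<le> Im (moebius_int A \<tau>)" if "B \<in> carrier SL2Z" for B
  proof -
    have "(cmod (moebius_denom A \<tau>))\<^sup>2 \<le> (cmod (moebius_denom B \<tau>))\<^sup>2"
      using minA[OF that] by (simp add: power_mono)
    then show ?thesis
      using A(1) that \<tau> moebius_denom_nonzero by (simp add: Im_moebius_int frac_le)
  qed
  define n where "n = - round (Re (moebius_int A \<tau>))"
  define B where "B = mat2 1 n 0 1 ** A"
  have B: "B \<in> carrier SL2Z"
    unfolding B_def using SL2Z.m_closed[OF translation_in_SL2Z A(1)] by simp
  have mB: "moebius_int B \<tau> = moebius_int A \<tau> + of_int n"
    unfolding B_def using moebius_int_mult[OF translation_in_SL2Z A(1) \<tau>] by simp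
  have Re: "\<bar>Re (moebius_int B \<tau>)\<bar> \<le> 1 / 2"
    using of_int_round_abs_le[of "Re (moebius_int A \<tau>)"] unfolding mB n_def by (simp add: abs_if split: if_splits)
  define w where "w = moebius_int B \<tau>"
  have w: "Im w > 0" unfolding w_def using B \<tau> by (rule Im_moebius_int_pos)
  \<comment> \<open>The inversion -1/w cannot raise a highest point, so w has modulus at least 1;
    together with |Re w| at most 1/2 this leaves Im w at least sqrt 3 / 2.\<close>
  define S' where "S' = mat2 0 (-1) 1 0"
  have S': "S' \<in> carrier SL2Z" by (simp add: S'_def SL2Z_carrier_iff)
  have "Im (moebius_int S' w) \<le> Im w"
  proof -
    have "moebius_int S' w = moebius_int (S' ** B) \<tau>"
      unfolding w_def using moebius_int_mult[OF S' B \<tau>] by simp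
    also have "Im \<dots> \<le> Im (moebius_int A \<tau>)"
      using SL2Z.m_closed[OF S' B] by (intro ImA) simp
    finally show ?thesis by (simp add: w_def mB)
  qed
  moreover have "Im (moebius_int S' w) = Im w / (cmod w)\<^sup>2"
    using Im_moebius_int[OF S' w] by (simp add: moebius_denom_def S'_def)
  moreover have "(cmod w)\<^sup>2 > 0" using w by auto
  ultimately have "1 \<le> (cmod w)\<^sup>2"
    using w by (simp add: field_simps)
  moreover have "(Re w)\<^sup>2 \<le> (1 / 2)\<^sup>2"
    using Re unfolding w_def by (metis abs_le_square_iff abs_of_nonneg zero_le_divide_1_iff zero_le_numeral)
  ultimately have "(sqrt 3 / 2)\<^sup>2 \<le> (Im w)\<^sup>2"
    by (simp add: cmod_power2 power_divide)
  then have "sqrt 3 / 2 \<le> Im w"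
    using w by (intro power2_le_imp_le[of "sqrt 3 / 2" "Im w"]) simp_all
  then show ?thesis using that B Re unfolding w_def by blast
qed

section \<open>A vanishing criterion of Siegel type\<close>

text \<open>The invariant function |f| v^(W/2) becomes small at high reduced points, so it attains
  its maximum at a reduced point \<open>\<tau>\<^sub>0\<close>, of height at least sqrt 3 / 2. Near
  that height the weight factor can be traded for an exponential, and the maximum modulus principle
  on a half-plane makes the twisted function constant, against its decay.\<close>

lemma moebius_invariant_vanishing:
  fixes f :: "complex \<Rightarrow> complex" and W n :: real
  assumes hol: "f holomorphic_on upper_half_plane"
    and inv: "\<And>A \<tau>. A \<in> carrier SL2Z \<Longrightarrow> Im \<tau> > 0 \<Longrightarrow>
      cmod (f (moebius_int A \<tau>)) * Im (moebius_int A \<tau>) powr (W / 2) = cmod (f \<tau>) * Im \<tau> powr (W / 2)"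
    and decay: "\<And>v. v > 0 \<Longrightarrow> \<exists>C. \<forall>\<tau>. Im \<tau> \<ge> v \<longrightarrow> cmod (f \<tau>) \<le> C * exp (- 2 * pi * n * Im \<tau>)"
    and W: "W \<ge> 0" and n: "n > W / (2 * pi * sqrt 3)"
    and \<tau>: "Im \<tau> > 0"
  shows "f \<tau> = 0"
proof (rule ccontr)
  assume "f \<tau> \<noteq> 0"
  define F where "F \<tau> = cmod (f \<tau>) * Im \<tau> powr (W / 2)" for \<tau>
  have npos: "n > 0" using n W by (smt (verit) divide_nonneg_nonneg pi_gt_zero real_sqrt_ge_zero mult_nonneg_nonneg)
  have F\<tau>: "F \<tau> > 0" using \<open>f \<tau> \<noteq> 0\<close> \<tau> by (simp add: F_def)
  have s3: "sqrt 3 / 2 > (0::real)" by simp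
  have contF: "continuous_on upper_half_plane F"
    unfolding F_def using holomorphic_on_imp_continuous_on[OF hol]
    by (intro continuous_intros) auto

  obtain C where C: "\<And>\<tau>. Im \<tau> \<ge> sqrt 3 / 2 \<Longrightarrow> cmod (f \<tau>) \<le> C * exp (- 2 * pi * n * Im \<tau>)"
    using decay[OF s3] by blast
  have "((\<lambda>v. C * exp (- 2 * pi * n * v) * v powr (W / 2)) \<longlongrightarrow> 0) at_top"
    using npos by real_asymp
  then have "\<forall>\<^sub>F v in at_top. C * exp (- 2 * pi * n * v) * v powr (W / 2) < F \<tau>"
    using F\<tau> by (rule order_tendstoD)
  then obtain V where V: "\<And>v. v \<ge> V \<Longrightarrow> C * exp (- 2 * pi * n * v) * v powr (W / 2) < F \<tau>"
    by (auto simp: eventually_at_top_linorder)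
  \<comment> \<open>Above height \<open>V\<close> the function stays below its value at the given
    point, so only the box \<open>D\<close> can carry the maximum; the \<open>max\<close> keeps
    \<open>D\<close> nonempty.\<close>
  define V' where "V' = max V (sqrt 3 / 2)"
  define D where "D = cbox (Complex (-1/2) (sqrt 3 / 2)) (Complex (1/2) V')"
  have D_iff: "z \<in> D \<longleftrightarrow> \<bar>Re z\<bar> \<le> 1 / 2 \<and> sqrt 3 / 2 \<le> Im z \<and> Im z \<le> V'" for z
    by (auto simp: D_def in_cbox_complex_iff abs_le_iff)
  have red: "\<exists>w\<in>D. F z = F w \<or> F z < F \<tau>" if z: "Im z > 0" for z
  proof -
    obtain A where A: "A \<in> carrier SL2Z" "\<bar>Re (moebius_int A z)\<bar> \<le> 1 / 2"
      "Im (moebius_int A z) \<ge> sqrt 3 / 2"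
      using exists_moebius_reduced[OF z] .
    have Fz: "F (moebius_int A z) = F z" unfolding F_def using inv[OF A(1) z] .
    show ?thesis
    proof (cases "Im (moebius_int A z) \<le> V'")
      case True
      then have "moebius_int A z \<in> D" using A by (simp add: D_iff)
      then show ?thesis using Fz by metis
    next
      case False
      let ?w = "moebius_int A z"
      have "F ?w \<le> C * exp (- 2 * pi * n * Im ?w) * Im ?w powr (W / 2)"
        unfolding F_def by (intro mult_right_mono C A) auto
      also have "\<dots> < F \<tau>" using V False by (simp add: V'_def)
      finally have "F z < F \<tau>" using Fz by simp
      moreover have "Complex 0 (sqrt 3 / 2) \<in> D" by (simp add: D_iff V'_def)
      ultimately show ?thesis by blast
    qed
  qed
  have D_sub: "D \<subseteq> upper_half_plane" 
  proof
    fix z assume "z \<in> D"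
    then have "sqrt 3 / 2 \<le> Im z" by (simp add: D_iff)
    then show "z \<in> upper_half_plane" using s3 unfolding mem_Collect_eq by (rule less_le_trans[rotated])
  qed
  obtain \<tau>' where \<tau>': "\<tau>' \<in> D" "F \<tau>' = F \<tau>" using red[OF \<tau>] by fastforce
  have "\<exists>x\<in>D. \<forall>y\<in>D. F y \<le> F x"
    using \<tau>'(1) continuous_on_subset[OF contF D_sub]
    by (intro continuous_attains_sup) (auto simp: D_def)
  then obtain \<tau>\<^sub>0 where \<tau>0: "\<tau>\<^sub>0 \<in> D" "\<And>y. y \<in> D \<Longrightarrow> F y \<le> F \<tau>\<^sub>0" by blast
  have max: "F z \<le> F \<tau>\<^sub>0" if "Im z > 0" for z
    using red[OF that] \<tau>0(2) \<tau>' by fastforce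
  have F0: "F \<tau>\<^sub>0 > 0" using max[OF \<tau>] F\<tau> by simp
  define v\<^sub>0 where "v\<^sub>0 = Im \<tau>\<^sub>0"
  have v0: "v\<^sub>0 \<ge> sqrt 3 / 2" "v\<^sub>0 > 0" using \<tau>0(1) s3 unfolding v\<^sub>0_def D_iff by linarith+

  text \<open>For \<open>\<alpha> > W / (2 v\<^sub>0)\<close> the bound \<open>v powr (-W/2) * exp (\<alpha> v)\<close> increases near \<open>v\<^sub>0\<close>, so
    \<open>f \<tau> * exp (-i\<alpha>\<tau>)\<close> attains its maximum over \<open>Im \<tau> \<ge> v\<^sub>1\<close> in the interior.\<close>
  obtain \<alpha> where \<alpha>: "W / sqrt 3 < \<alpha>" "\<alpha> < 2 * pi * n"
    using dense[of "W / sqrt 3" "2 * pi * n"] n by (auto simp: field_simps)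
  have \<alpha>pos: "\<alpha> > 0" using \<alpha>(1) W by (smt (verit) divide_nonneg_nonneg real_sqrt_ge_zero)
  have "W / (2 * \<alpha>) < sqrt 3 / 2"
    using \<alpha>(1) \<alpha>pos by (simp add: field_simps)
  with v0 have Wv: "W / (2 * \<alpha>) < v\<^sub>0" by linarith
  define v\<^sub>1 where "v\<^sub>1 = (W / (2 * \<alpha>) + v\<^sub>0) / 2"
  have "W / (2 * \<alpha>) \<ge> 0" using W \<alpha>pos by simp
  then have v1: "v\<^sub>1 > 0" "v\<^sub>1 < v\<^sub>0" "W / (2 * \<alpha>) < v\<^sub>1"
    using v0 Wv by (auto simp: v\<^sub>1_def)
  \<comment> \<open>\<open>v\<^sub>1\<close> is the midpoint of W / (2\<alpha>) and
    \<open>v\<^sub>0\<close>. The inequality ln x \<le> x - 1 at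
    \<open>x = v\<^sub>0 / v\<^sub>1\<close> bounds the gain of the power by that of the
    exponential.\<close>
  have bd: "v\<^sub>1 powr (- W / 2) * exp (\<alpha> * v\<^sub>1) < v\<^sub>0 powr (- W / 2) * exp (\<alpha> * v\<^sub>0)"
  proof -
    have "ln (v\<^sub>0 / v\<^sub>1) \<le> v\<^sub>0 / v\<^sub>1 - 1" using v1 v0 by (intro ln_le_minus_one) auto
    then have "(W / 2) * (ln v\<^sub>0 - ln v\<^sub>1) \<le> (W / 2) * ((v\<^sub>0 - v\<^sub>1) / v\<^sub>1)"
      using W v1 v0 by (intro mult_left_mono) (auto simp: ln_div diff_divide_distrib)
    also have "\<dots> = (W / (2 * v\<^sub>1)) * (v\<^sub>0 - v\<^sub>1)" by simp
    also have "\<dots> < \<alpha> * (v\<^sub>0 - v\<^sub>1)"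
      using v1 \<alpha>pos by (intro mult_strict_right_mono) (auto simp: field_simps)
    finally have "(- W / 2) * ln v\<^sub>1 + \<alpha> * v\<^sub>1 < (- W / 2) * ln v\<^sub>0 + \<alpha> * v\<^sub>0"
      by (simp add: algebra_simps diff_divide_distrib)
    then have "exp ((- W / 2) * ln v\<^sub>1 + \<alpha> * v\<^sub>1) < exp ((- W / 2) * ln v\<^sub>0 + \<alpha> * v\<^sub>0)" by simp
    then show ?thesis using v1 v0 unfolding exp_add powr_def by simp
  qed
  define h where "h z = f z * exp (- \<i> * of_real \<alpha> * z)" for z
  have norm_h: "cmod (h z) = cmod (f z) * exp (\<alpha> * Im z)" for z
    by (simp add: h_def norm_mult)
  have h_F: "cmod (h z) = F z * (Im z powr (- W / 2) * exp (\<alpha> * Im z))" if "Im z > 0" for z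
    using that by (simp add: norm_h F_def powr_minus)
  have hol_h: "h holomorphic_on upper_half_plane"
    unfolding h_def using hol by (intro holomorphic_intros)
  obtain C\<^sub>1 where C1: "\<And>\<tau>. Im \<tau> \<ge> v\<^sub>1 \<Longrightarrow> cmod (f \<tau>) \<le> C\<^sub>1 * exp (- 2 * pi * n * Im \<tau>)"
    using decay[OF v1(1)] by blast
  have h0: "cmod (h \<tau>\<^sub>0) > 0"
    using F0 v0 by (subst h_F) (auto simp: v\<^sub>0_def)
  define \<beta> where "\<beta> = 2 * pi * n - \<alpha>"
  have "\<beta> > 0" using \<alpha>(2) by (simp add: \<beta>_def)
  then have "((\<lambda>v. C\<^sub>1 * exp (- \<beta> * v)) \<longlongrightarrow> 0) at_top"
    by real_asymp
  moreover have "C\<^sub>1 * exp (- \<beta> * v) = C\<^sub>1 * exp (- 2 * pi * n * v) * exp (\<alpha> * v)" for v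
    unfolding mult.assoc exp_add[symmetric] by (simp add: \<beta>_def algebra_simps)
  ultimately have "((\<lambda>v. C\<^sub>1 * exp (- 2 * pi * n * v) * exp (\<alpha> * v)) \<longlongrightarrow> 0) at_top"
    by (simp only:)
  then have "\<forall>\<^sub>F v in at_top. C\<^sub>1 * exp (- 2 * pi * n * v) * exp (\<alpha> * v) < cmod (h \<tau>\<^sub>0)"
    using h0 by (rule order_tendstoD)
  then obtain U where U: "\<And>v. v \<ge> U \<Longrightarrow> C\<^sub>1 * exp (- 2 * pi * n * v) * exp (\<alpha> * v) < cmod (h \<tau>\<^sub>0)"
    by (auto simp: eventually_at_top_linorder)
  have h_large: "cmod (h z) < cmod (h \<tau>\<^sub>0)" if "Im z \<ge> U" "Im z \<ge> v\<^sub>1" for z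
  proof -
    have "cmod (h z) \<le> C\<^sub>1 * exp (- 2 * pi * n * Im z) * exp (\<alpha> * Im z)"
      unfolding norm_h by (intro mult_right_mono C1 that) auto
    also have "\<dots> < cmod (h \<tau>\<^sub>0)" using U that by simp
    finally show ?thesis .
  qed
  have h_trans: "cmod (h (z + of_int j)) = cmod (h z)" if "Im z > 0" for z and j :: int
    using inv[OF translation_in_SL2Z that, of j] that by (simp add: norm_h)
  define U' where "U' = max U v\<^sub>0"
  define R where "R = cbox (Complex (-1/2) v\<^sub>1) (Complex (1/2) U')"
  have R_iff: "z \<in> R \<longleftrightarrow> \<bar>Re z\<bar> \<le> 1 / 2 \<and> v\<^sub>1 \<le> Im z \<and> Im z \<le> U'" for z
    by (auto simp: R_def in_cbox_complex_iff abs_le_iff)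
  have R_sub: "R \<subseteq> upper_half_plane" using v1 by (auto simp: R_iff)
  have \<tau>0R: "\<tau>\<^sub>0 \<in> R" using \<tau>0(1) v1 by (auto simp: R_iff D_iff U'_def v\<^sub>0_def)
  have "\<exists>x\<in>R. \<forall>y\<in>R. cmod (h y) \<le> cmod (h x)"
    using \<tau>0R continuous_on_subset[OF holomorphic_on_imp_continuous_on[OF hol_h] R_sub]
    by (intro continuous_attains_sup continuous_intros) (auto simp: R_def)
  then obtain \<xi> where \<xi>: "\<xi> \<in> R" "\<And>y. y \<in> R \<Longrightarrow> cmod (h y) \<le> cmod (h \<xi>)" by blast
  \<comment> \<open>Integer translations preserve |h| and bring any point into the strip of
    \<open>R\<close>; above \<open>U'\<close> the decay keeps |h| below its value at
    \<open>\<tau>\<^sub>0\<close>.\<close>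
  have \<xi>_max: "cmod (h z) \<le> cmod (h \<xi>)" if z: "Im z \<ge> v\<^sub>1" for z
  proof (cases "Im z \<le> U'")
    case True
    define w where "w = z + of_int (- round (Re z))"
    have "w \<in> R" using of_int_round_abs_le[of "Re z"] True z by (simp add: R_iff w_def abs_minus_commute)
    then have "cmod (h w) \<le> cmod (h \<xi>)" by (rule \<xi>)
    moreover have "cmod (h w) = cmod (h z)" unfolding w_def using z v1 by (intro h_trans) auto
    ultimately show ?thesis by simp
  next
    case False
    then have "U \<le> Im z" by (simp add: U'_def)
    then show ?thesis using h_large[of z] z \<xi>(2)[OF \<tau>0R] by linarith
  qed
  \<comment> \<open>On the lower edge |h| is \<open>F\<close> times the left side of
    \<open>bd\<close>, and \<open>F\<close> is at most \<open>F \<tau>\<^sub>0\<close>, so |h| is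
    smaller there than at \<open>\<tau>\<^sub>0\<close>.\<close>
  have \<xi>_int: "Im \<xi> > v\<^sub>1"
  proof (rule ccontr)
    assume "\<not> ?thesis"
    with \<xi>(1) have eq: "Im \<xi> = v\<^sub>1" by (simp add: R_iff)
    have "cmod (h \<xi>) = F \<xi> * (v\<^sub>1 powr (- W / 2) * exp (\<alpha> * v\<^sub>1))"
      using h_F[of \<xi>] eq v1 by simp
    also have "\<dots> \<le> F \<tau>\<^sub>0 * (v\<^sub>1 powr (- W / 2) * exp (\<alpha> * v\<^sub>1))"
      using max[of \<xi>] eq v1 by (intro mult_right_mono) auto
    also have "\<dots> < F \<tau>\<^sub>0 * (v\<^sub>0 powr (- W / 2) * exp (\<alpha> * v\<^sub>0))"
      using bd F0 by (intro mult_strict_left_mono)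
    also have "\<dots> = cmod (h \<tau>\<^sub>0)" using h_F[of \<tau>\<^sub>0] v0 by (simp add: v\<^sub>0_def)
    finally show False using \<xi>(2)[OF \<tau>0R] by simp
  qed
  define H where "H = {z. Im z > v\<^sub>1}"
  have "h constant_on H"
  proof (rule maximum_modulus_principle[of h H H \<xi>])
    show "h holomorphic_on H" using v1 by (intro holomorphic_on_subset[OF hol_h]) (auto simp: H_def)
    show "open H" by (simp add: H_def open_halfspace_Im_gt)
    show "connected H" unfolding H_def by (intro convex_connected convex_halfspace_Im_gt)
    show "\<xi> \<in> H" using \<xi>_int by (simp add: H_def)
    show "\<And>z. z \<in> H \<Longrightarrow> cmod (h z) \<le> cmod (h \<xi>)" by (intro \<xi>_max) (simp add: H_def)
  qed (auto simp: H_def open_halfspace_Im_gt)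
  moreover define z\<^sub>1 where "z\<^sub>1 = Complex 0 (U' + 1)"
  have "\<tau>\<^sub>0 \<in> H" "z\<^sub>1 \<in> H" using v1 by (auto simp: H_def z\<^sub>1_def v\<^sub>0_def U'_def)
  ultimately have "h \<tau>\<^sub>0 = h z\<^sub>1" by (auto simp: constant_on_def)
  moreover have "cmod (h z\<^sub>1) < cmod (h \<tau>\<^sub>0)"
    using v1 by (intro h_large) (auto simp: z\<^sub>1_def U'_def)
  ultimately show False by simp
qed

section \<open>Invariant absolute values at torsion points\<close>

definition row_action :: "int^2^2 \<Rightarrow> real \<times> real \<Rightarrow> real \<times> real" where
  "row_action A p = (of_int (A$1$1) * fst p + of_int (A$2$1) * snd p,
                     of_int (A$1$2) * fst p + of_int (A$2$2) * snd p)"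

lemma row_action_mult: "row_action (A ** B) p = row_action B (row_action A p)"
  by (simp add: row_action_def mat2_mult_nth algebra_simps)

lemma row_action_one [simp]: "row_action (mat 1) p = p"
  by (simp add: row_action_def mat_one_nth)

lemma row_action_adj2:
  assumes "A \<in> carrier SL2Z"
  shows "row_action A (row_action (adj2 A) p) = p"
  using adj2_mult(1)[OF assms] by (metis row_action_mult row_action_one)

text \<open>At z = \<lambda>\<tau> + \<mu> one has \<lambda> = y / v with y = Im z and v = Im
  \<tau>, so this is the square root of the Petersson density |\<psi>|^2 v^k exp(-4 pi m y^2 /
  v).\<close>

definition jacobi_norm :: "nat \<Rightarrow> nat \<Rightarrow> (complex \<Rightarrow> complex \<Rightarrow> complex) \<Rightarrow> real \<times> real \<Rightarrow> complex \<Rightarrow> real" where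
  "jacobi_norm k m \<psi> p \<tau> = Im \<tau> powr (real k / 2) *
     cmod (exp (2 * of_real pi * \<i> * of_nat m * of_real ((fst p)\<^sup>2) * \<tau>)
           * \<psi> \<tau> (of_real (fst p) * \<tau> + of_real (snd p)))"

text \<open>With J = c\<tau> + d, the point with coordinates p relative to A\<tau> is z / J, where z
  has coordinates pA relative to \<tau>. The power of J is absorbed by Im (A\<tau>) = Im \<tau> /
  |J|^2, and the remaining exponentials match by \<open>key\<close>.\<close>

lemma jacobi_norm_slash:
  assumes A: "A \<in> carrier SL2Z" and \<tau>: "Im \<tau> > 0"
  shows "jacobi_norm k m (jacobi_slash k m \<phi> A) (row_action A p) \<tau> = jacobi_norm k m \<phi> p (moebius_int A \<tau>)"
proof -
  define l u where "l = fst p" and "u = snd p"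
  define a b c d where "a = real_of_int (A$1$1)" and "b = real_of_int (A$1$2)"
    and "c = real_of_int (A$2$1)" and "d = real_of_int (A$2$2)"
  have det: "a * d - b * c = 1"
    using arg_cong[OF A[unfolded SL2Z_carrier_iff], of real_of_int]
    by (simp add: a_def b_def c_def d_def)
  define J where "J = moebius_denom A \<tau>"
  have J: "J \<noteq> 0" unfolding J_def by (rule moebius_denom_nonzero[OF A \<tau>])
  define z where "z = complex_of_real (a * l + c * u) * \<tau> + of_real (b * l + d * u)"
  have J_eq: "J = of_real c * \<tau> + of_real d" by (simp add: J_def moebius_denom_def c_def d_def)
  have M_eq: "moebius_int A \<tau> * J = of_real a * \<tau> + of_real b"
    using J by (simp add: J_def moebius_int_def a_def b_def)
  have "(of_real l * moebius_int A \<tau> + of_real u) * J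
      = of_real l * (moebius_int A \<tau> * J) + of_real u * J" by algebra
  also have "\<dots> = z" unfolding M_eq unfolding J_eq z_def by (simp add: algebra_simps)
  finally have zJ: "z / J = of_real l * moebius_int A \<tau> + of_real u"
    using J by (simp add: field_simps)
  have Im': "Im (moebius_int A \<tau>) = Im \<tau> / (cmod J)\<^sup>2"
    unfolding J_def by (rule Im_moebius_int[OF A \<tau>])
  \<comment> \<open>Clearing the denominator |J|^2 leaves a polynomial identity modulo ad - bc =
    1.\<close>
  have key: "(a * l + c * u)\<^sup>2 * Im \<tau> - Im (of_real c * z\<^sup>2 / J) = l\<^sup>2 * Im (moebius_int A \<tau>)"
  proof -
    obtain x y where xy: "\<tau> = Complex x y" by (cases \<tau>)
    have sq: "(cmod J)\<^sup>2 = (c * x + d)\<^sup>2 + (c * y)\<^sup>2"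
      unfolding cmod_power2 J_eq by (simp add: xy)
    have pos: "(cmod J)\<^sup>2 > 0" using J by simp
    define X where "X = (a * l + c * u) * x + (b * l + d * u)"
    define Y where "Y = (a * l + c * u) * y"
    have "Im (of_real c * z\<^sup>2 / J) = Im (of_real c * z\<^sup>2 * cnj J) / (cmod J)\<^sup>2"
      using complex_div_cnj[of "of_real c * z\<^sup>2" J] by (simp flip: of_real_power)
    also have "Im (of_real c * z\<^sup>2 * cnj J) = c * (2 * X * Y * (c * x + d) - (X\<^sup>2 - Y\<^sup>2) * (c * y))"
      unfolding J_eq z_def xy X_def Y_def by (simp add: power2_eq_square algebra_simps)
    finally have Im_eq: "Im (of_real c * z\<^sup>2 / J)
        = c * (2 * X * Y * (c * x + d) - (X\<^sup>2 - Y\<^sup>2) * (c * y)) / (cmod J)\<^sup>2" .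
    have cancel: "r * (P - Q / r) = P * r - Q" if "r > 0" for r P Q :: real
      using that by (simp add: field_simps)
    have "(cmod J)\<^sup>2 * ((a * l + c * u)\<^sup>2 * Im \<tau> - Im (of_real c * z\<^sup>2 / J))
        = (a * l + c * u)\<^sup>2 * y * ((c * x + d)\<^sup>2 + (c * y)\<^sup>2)
          - c * (2 * X * Y * (c * x + d) - (X\<^sup>2 - Y\<^sup>2) * (c * y))"
      unfolding Im_eq cancel[OF pos] unfolding sq by (simp add: xy)
    also have "\<dots> = l\<^sup>2 * y"
      using det unfolding X_def Y_def by algebra
    finally show ?thesis
      using pos unfolding Im' by (simp add: xy field_simps)
  qed
  have "(Im \<tau> / (cmod J)\<^sup>2) powr (real k / 2) = Im \<tau> powr (real k / 2) * cmod (J powi (- int k))"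
  proof -
    have "((cmod J)\<^sup>2) powr (real k / 2) = cmod J powr real k"
      using J by (simp add: powr_powr flip: powr_numeral)
    also have "\<dots> = cmod J ^ k" using J by (simp add: powr_realpow)
    finally have *: "((cmod J)\<^sup>2) powr (real k / 2) = cmod J ^ k" .
    have "cmod (J powi (- int k)) = inverse (cmod J ^ k)"
      by (simp add: power_int_minus norm_inverse norm_power)
    moreover have "(Im \<tau> / (cmod J)\<^sup>2) powr (real k / 2)
        = Im \<tau> powr (real k / 2) / ((cmod J)\<^sup>2) powr (real k / 2)"
      using \<tau> by (intro powr_divide)
    ultimately show ?thesis unfolding * by (simp only: divide_inverse)
  qed
  moreover have "cmod (exp (2 * of_real pi * \<i> * of_nat m * of_real ((a * l + c * u)\<^sup>2) * \<tau>)
       * exp (- 2 * of_real pi * \<i> * of_nat m * (of_real c * z\<^sup>2 / J)))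
      = cmod (exp (2 * of_real pi * \<i> * of_nat m * of_real (l\<^sup>2) * moebius_int A \<tau>))"
  proof -
    have "- (2 * pi * real m * ((a * l + c * u)\<^sup>2 * Im \<tau>)) + 2 * pi * real m * Im (of_real c * z\<^sup>2 / J)
        = - (2 * pi * real m * (l\<^sup>2 * Im (moebius_int A \<tau>)))"
      unfolding key[symmetric] by (simp add: algebra_simps)
    moreover have "Re (2 * of_real pi * \<i> * of_nat m * of_real s * w) = - (2 * pi * real m * (s * Im w))"
      "Re (- 2 * of_real pi * \<i> * of_nat m * w) = 2 * pi * real m * Im w" for s w
      by simp_all
    ultimately show ?thesis
      unfolding norm_mult norm_exp_eq_Re exp_add[symmetric] by (simp only: plus_complex.sel)
  qed
  moreover have "jacobi_slash k m \<phi> A \<tau> z = J powi (- int k)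
       * exp (- 2 * of_real pi * \<i> * of_nat m * (of_real c * z\<^sup>2 / J))
       * \<phi> (moebius_int A \<tau>) (of_real l * moebius_int A \<tau> + of_real u)"
    unfolding zJ[symmetric] by (simp add: jacobi_slash_def Let_def J_def moebius_int_def moebius_denom_def c_def)
  ultimately show ?thesis
    unfolding jacobi_norm_def Im'
    by (simp add: row_action_def norm_mult z_def a_def[symmetric] b_def[symmetric] c_def[symmetric]
        d_def[symmetric] l_def[symmetric] u_def[symmetric] mult_ac)
qed

lemma jacobi_slash_one:
  "jacobi_slash k m \<phi> (mat 1) = \<phi>"
  by (simp add: jacobi_slash_def mat_one_nth fun_eq_iff)

text \<open>Reduction of the entries modulo \<open>N\<close> has finite range and determines the
  coset: if A and B agree modulo \<open>N\<close>, then A times the inverse of B lies in the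
  principal congruence subgroup.\<close>

lemma finite_index_congruence_subgroup:
  assumes "congruence_subgroup \<Gamma>"
  shows "finite (rcosets\<^bsub>SL2Z\<^esub> \<Gamma>)"
proof -
  obtain N where sub: "subgroup \<Gamma> SL2Z" and N: "N > 0" "principal_congruence_subgroup N \<subseteq> \<Gamma>"
    using assms by (auto simp: congruence_subgroup_def)
  define red where "red A = (A$1$1 mod int N, A$1$2 mod int N, A$2$1 mod int N, A$2$2 mod int N)" for A :: "int^2^2"
  define I where "I = {0..<int N} \<times> {0..<int N} \<times> {0..<int N} \<times> {0..<int N}"
  have eq: "\<Gamma> #>\<^bsub>SL2Z\<^esub> A = \<Gamma> #>\<^bsub>SL2Z\<^esub> B"
    if A: "A \<in> carrier SL2Z" and B: "B \<in> carrier SL2Z" and r: "red A = red B" for A B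
  proof -
    define C where "C = A ** adj2 B"
    have CB: "C ** B = A" using adj2_mult(1)[OF B] by (simp add: C_def flip: matrix_mul_assoc)
    have C: "C \<in> carrier SL2Z"
      using SL2Z.m_closed[OF A adj2_in_SL2Z[OF B]] by (simp add: C_def)
    have cong: "(A$i$1 * x + A$i$2 * y) mod int N = (B$i$1 * x + B$i$2 * y) mod int N" for i :: 2 and x y
    proof -
      have "A$i$1 mod int N = B$i$1 mod int N" "A$i$2 mod int N = B$i$2 mod int N"
        using r exhaust_2[of i] by (auto simp: red_def)
      then show ?thesis by (intro mod_add_cong mod_mult_cong) auto
    qed
    have "C $ i $ j mod int N = (B ** adj2 B) $ i $ j mod int N" for i j
      unfolding C_def mat2_mult_nth by (rule cong)
    then have "C \<in> principal_congruence_subgroup N"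
      using C adj2_mult(2)[OF B] by (auto simp: principal_congruence_subgroup_def)
    with N have "C \<in> \<Gamma>" by blast
    then have "A \<in> \<Gamma> #>\<^bsub>SL2Z\<^esub> B"
      unfolding r_coset_def using CB by force
    then show ?thesis using SL2Z.repr_independence[OF _ B sub] by simp
  qed
  have "finite (red ` carrier SL2Z)"
    by (rule finite_subset[of _ I]) (use N in \<open>auto simp: red_def I_def\<close>)
  moreover define g where "g x = \<Gamma> #>\<^bsub>SL2Z\<^esub> (SOME A. A \<in> carrier SL2Z \<and> red A = x)" for x
  have "g (red A) = \<Gamma> #>\<^bsub>SL2Z\<^esub> A" if A: "A \<in> carrier SL2Z" for A
  proof -
    have "\<exists>B. B \<in> carrier SL2Z \<and> red B = red A" using A by blast
    then have "(SOME B. B \<in> carrier SL2Z \<and> red B = red A) \<in> carrier SL2Z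
      \<and> red (SOME B. B \<in> carrier SL2Z \<and> red B = red A) = red A" by (rule someI_ex)
    then show ?thesis unfolding g_def using A by (intro eq) auto
  qed
  then have "rcosets\<^bsub>SL2Z\<^esub> \<Gamma> \<subseteq> g ` red ` carrier SL2Z"
    unfolding RCOSETS_def by force
  ultimately show ?thesis by (meson finite_imageI finite_subset)
qed

section \<open>Transformation laws of the absolute values of one Jacobi form\<close>

locale jacobi_form =
  fixes k m :: nat and \<Gamma> :: "(int^2^2) set" and chi :: "int^2^2 \<Rightarrow> complex"
    and \<phi> :: "complex \<Rightarrow> complex \<Rightarrow> complex"
  assumes congruence: "congruence_subgroup \<Gamma>"
    and character: "finite_order_character \<Gamma> chi"
    and form: "\<phi> \<in> jacobi_forms k m \<Gamma> chi"
begin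

lemma \<Gamma>_subgroup: "subgroup \<Gamma> SL2Z"
  using congruence by (simp add: congruence_subgroup_def)

lemma \<Gamma>_sub: "\<Gamma> \<subseteq> carrier SL2Z"
  by (rule subgroup.subset[OF \<Gamma>_subgroup])

definition slash_abs :: "int^2^2 \<Rightarrow> real \<times> real \<Rightarrow> complex \<Rightarrow> real" where
  "slash_abs A = jacobi_norm k m (jacobi_slash k m \<phi> A)"

lemma slash_abs_row_action:
  assumes "A \<in> carrier SL2Z" "Im \<tau> > 0"
  shows "slash_abs A (row_action A p) \<tau> = slash_abs (mat 1) p (moebius_int A \<tau>)"
  unfolding slash_abs_def jacobi_slash_one by (rule jacobi_norm_slash[OF assms])

text \<open>\<open>slash_abs_row_action\<close> turns both sides into the value for the identity
  matrix at the same point; composition of Moebius maps thus replaces the cocycle rule of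
  \<open>jacobi_slash\<close>.\<close>

lemma slash_abs_mult:
  assumes A: "A \<in> carrier SL2Z" and B: "B \<in> carrier SL2Z" and \<tau>: "Im \<tau> > 0"
  shows "slash_abs (A ** B) (row_action B p) \<tau> = slash_abs A p (moebius_int B \<tau>)"
proof -
  define q where "q = row_action (adj2 A) p"
  have p: "p = row_action A q" by (simp add: q_def row_action_adj2 A)
  have AB: "A ** B \<in> carrier SL2Z" using SL2Z.m_closed[OF A B] by simp
  show ?thesis
    using slash_abs_row_action[OF AB \<tau>, of q] slash_abs_row_action[OF A Im_moebius_int_pos[OF B \<tau>], of q]
    by (simp add: p row_action_mult moebius_int_mult[OF A B \<tau>])
qed

lemma norm_character:
  assumes "C \<in> \<Gamma>"
  shows "cmod (chi C) = 1"
proof -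
  obtain n :: nat where "n > 0" "chi C ^ n = 1"
    using character assms by (auto simp: finite_order_character_def)
  then have "cmod (chi C) ^ n = 1 ^ n" by (metis norm_one norm_power power_one)
  then show ?thesis using \<open>n > 0\<close> by (intro power_eq_imp_eq_base[of _ n 1]) auto
qed

text \<open>Since \<open>chi\<close> has modulus one on \<open>\<Gamma>\<close>, the absolute values
  depend only on the coset of A, which makes a product over cosets meaningful.\<close>

lemma slash_abs_\<Gamma>_mult:
  assumes C: "C \<in> \<Gamma>" and A: "A \<in> carrier SL2Z" and \<tau>: "Im \<tau> > 0"
  shows "slash_abs (C ** A) p \<tau> = slash_abs A p \<tau>"
proof -
  define q where "q = row_action (adj2 A) p"
  define \<tau>' where "\<tau>' = moebius_int A \<tau>"
  have p: "p = row_action A q" by (simp add: q_def row_action_adj2 A)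
  have \<tau>': "Im \<tau>' > 0" unfolding \<tau>'_def by (rule Im_moebius_int_pos[OF A \<tau>])
  have C': "C \<in> carrier SL2Z" using C \<Gamma>_sub by blast
  have "jacobi_slash k m \<phi> C \<tau>' z = chi C * \<phi> \<tau>' z" for z
    using form C \<tau>' by (simp add: jacobi_forms_def)
  then have "slash_abs C q \<tau>' = slash_abs (mat 1) q \<tau>'"
    by (simp add: slash_abs_def jacobi_norm_def norm_mult norm_character[OF C] jacobi_slash_one)
  then show ?thesis
    using slash_abs_mult[OF C' A \<tau>, of q] slash_abs_row_action[OF A \<tau>, of q] by (simp add: p \<tau>'_def)
qed

text \<open>The elliptic factor completes x^2 to (x + l)^2 in the exponent and leaves only the phase
  exp(4 pi i m l y).\<close>

lemma slash_abs_one_periodic: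
  assumes \<tau>: "Im \<tau> > 0"
  shows "slash_abs (mat 1) (x + of_int l, y + of_int u) \<tau> = slash_abs (mat 1) (x, y) \<tau>"
proof -
  define z where "z = of_real x * \<tau> + complex_of_real y"
  have "exp (2 * of_real pi * \<i> * of_nat m * ((of_int l)\<^sup>2 * \<tau> + 2 * of_int l * z))
          * \<phi> \<tau> (z + of_int l * \<tau> + of_int u) = \<phi> \<tau> z"
    using form \<tau> by (simp add: jacobi_forms_def)
  then have "exp (2 * of_real pi * \<i> * of_nat m * of_real (x\<^sup>2) * \<tau>) * \<phi> \<tau> z =
     exp (2 * of_real pi * \<i> * of_nat m * of_real (x\<^sup>2) * \<tau>)
       * exp (2 * of_real pi * \<i> * of_nat m * ((of_int l)\<^sup>2 * \<tau> + 2 * of_int l * z))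
       * \<phi> \<tau> (z + of_int l * \<tau> + of_int u)" by (simp add: mult.assoc)
  also have "exp (2 * of_real pi * \<i> * of_nat m * of_real (x\<^sup>2) * \<tau>)
       * exp (2 * of_real pi * \<i> * of_nat m * ((of_int l)\<^sup>2 * \<tau> + 2 * of_int l * z))
     = exp (2 * of_real pi * \<i> * of_nat m * of_real ((x + of_int l)\<^sup>2) * \<tau>)
       * exp (\<i> * of_real (4 * pi * m * l * y))"
    unfolding exp_add[symmetric] z_def by (simp add: power2_eq_square algebra_simps)
  also have "z + of_int l * \<tau> + of_int u = of_real (x + of_int l) * \<tau> + of_real (y + of_int u)"
    by (simp add: z_def algebra_simps)
  finally have "cmod (exp (2 * of_real pi * \<i> * of_nat m * of_real (x\<^sup>2) * \<tau>) * \<phi> \<tau> z)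
     = cmod (exp (2 * of_real pi * \<i> * of_nat m * of_real ((x + of_int l)\<^sup>2) * \<tau>)
        * \<phi> \<tau> (of_real (x + of_int l) * \<tau> + of_real (y + of_int u)))"
    by (simp only: norm_mult norm_exp_i_times mult_1_right)
  then show ?thesis
    by (simp add: slash_abs_def jacobi_norm_def jacobi_slash_one z_def)
qed

text \<open>SL(2,Z) preserves the lattice of integer translations: (l', u') is (l, u) times the
  inverse of A, and the case of the identity matrix applies at A\<tau>.\<close>

lemma slash_abs_periodic:
  assumes A: "A \<in> carrier SL2Z" and \<tau>: "Im \<tau> > 0"
  shows "slash_abs A (x + of_int l, y + of_int u) \<tau> = slash_abs A (x, y) \<tau>"
proof -
  define q where "q = row_action (adj2 A) (x, y)"
  define l' u' where "l' = A$2$2 * l - A$2$1 * u" and "u' = A$1$1 * u - A$1$2 * l"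
  have q: "(x, y) = row_action A q" by (simp add: q_def row_action_adj2 A)
  have "row_action (adj2 A) (x + of_int l, y + of_int u) = (fst q + of_int l', snd q + of_int u')"
    by (simp add: q_def row_action_def adj2_def l'_def u'_def algebra_simps)
  then have "(x + of_int l, y + of_int u) = row_action A (fst q + of_int l', snd q + of_int u')"
    by (metis A row_action_adj2)
  then have "slash_abs A (x + of_int l, y + of_int u) \<tau> = slash_abs (mat 1) (fst q + of_int l', snd q + of_int u') (moebius_int A \<tau>)"
    by (simp add: slash_abs_row_action[OF A \<tau>])
  also have "\<dots> = slash_abs (mat 1) q (moebius_int A \<tau>)"
    by (subst slash_abs_one_periodic) (simp_all add: Im_moebius_int_pos[OF A \<tau>])
  also have "\<dots> = slash_abs A (x, y) \<tau>" by (simp add: q slash_abs_row_action[OF A \<tau>])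
  finally show ?thesis .
qed

section \<open>Permutation of cosets and torsion points, and the invariant product\<close>

definition coset_rep :: "(int^2^2) set \<Rightarrow> int^2^2" where
  "coset_rep X = (SOME A. A \<in> X)"

lemma coset_rep:
  assumes "X \<in> rcosets\<^bsub>SL2Z\<^esub> \<Gamma>"
  shows "coset_rep X \<in> X" "coset_rep X \<in> carrier SL2Z"
proof -
  obtain A where A: "A \<in> carrier SL2Z" "X = \<Gamma> #>\<^bsub>SL2Z\<^esub> A"
    using assms by (auto simp: RCOSETS_def)
  then have "A \<in> X" using SL2Z.rcos_self[OF A(1) \<Gamma>_subgroup] by simp
  then show "coset_rep X \<in> X" unfolding coset_rep_def by (rule someI)
  then show "coset_rep X \<in> carrier SL2Z"
    using SL2Z.r_coset_subset_G[OF \<Gamma>_sub A(1)] A(2) by blast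
qed

lemma slash_abs_coset_rep:
  assumes X: "X \<in> rcosets\<^bsub>SL2Z\<^esub> \<Gamma>" and A: "A \<in> X" and \<tau>: "Im \<tau> > 0"
  shows "slash_abs (coset_rep X) p \<tau> = slash_abs A p \<tau>"
proof -
  have rep: "coset_rep X \<in> carrier SL2Z" "coset_rep X \<in> X" using coset_rep[OF X] by auto
  have "X = \<Gamma> #>\<^bsub>SL2Z\<^esub> coset_rep X"
    using X rep SL2Z.repr_independence[OF _ _ \<Gamma>_subgroup] by (auto simp: RCOSETS_def)
  then obtain C where "C \<in> \<Gamma>" "A = C ** coset_rep X"
    using A by (auto simp: r_coset_def)
  then show ?thesis using slash_abs_\<Gamma>_mult[OF _ rep(1) \<tau>] by simp
qed

text \<open>The origin is left out because \<phi>(\<tau>, 0) may vanish identically; SL(2,Z) still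
  permutes the remaining residue vectors.\<close>

definition torsion :: "int \<Rightarrow> (int \<times> int) set" where
  "torsion t = {0..<t} \<times> {0..<t} - {(0, 0)}"

definition torsion_pt :: "int \<Rightarrow> int \<times> int \<Rightarrow> real \<times> real" where
  "torsion_pt t e = (of_int (fst e) / of_int t, of_int (snd e) / of_int t)"

definition torsion_action :: "int \<Rightarrow> int^2^2 \<Rightarrow> int \<times> int \<Rightarrow> int \<times> int" where
  "torsion_action t A e = ((A$1$1 * fst e + A$2$1 * snd e) mod t, (A$1$2 * fst e + A$2$2 * snd e) mod t)"

lemma finite_torsion [simp]: "finite (torsion t)"
  by (simp add: torsion_def)

lemma torsion_action_mult:
  "torsion_action t B (torsion_action t A e) = torsion_action t (A ** B) e"
proof -
  have *: "(x * (p mod t) + y * (q mod t)) mod t = (x * p + y * q) mod t" for x y p q :: int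
    by (intro mod_add_cong mod_mult_cong) auto
  show ?thesis
    unfolding torsion_action_def fst_conv snd_conv mat2_mult_nth * by (simp add: algebra_simps)
qed

lemma torsion_action_one:
  assumes "e \<in> torsion t"
  shows "torsion_action t (mat 1) e = e"
  using assms by (auto simp: torsion_def torsion_action_def mat_one_nth)

lemma torsion_action_in:
  assumes t: "t > 0" and A: "A \<in> carrier SL2Z" and e: "e \<in> torsion t"
  shows "torsion_action t A e \<in> torsion t"
proof -
  have "torsion_action t A e \<noteq> (0, 0)"
  proof
    assume "torsion_action t A e = (0, 0)"
    then have "torsion_action t (adj2 A) (torsion_action t A e) = (0, 0)"
      by (simp add: torsion_action_def)
    then have "e = (0, 0)"
      using e by (simp add: torsion_action_mult adj2_mult A torsion_action_one)
    then show False using e by (simp add: torsion_def)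
  qed
  then show ?thesis using t by (simp add: torsion_def torsion_action_def)
qed

lemma bij_torsion_action:
  assumes t: "t > 0" and A: "A \<in> carrier SL2Z"
  shows "bij_betw (torsion_action t A) (torsion t) (torsion t)"
  by (rule bij_betw_byWitness[where f' = "torsion_action t (adj2 A)"])
     (use torsion_action_in[OF t A] torsion_action_in[OF t adj2_in_SL2Z[OF A]] in
       \<open>auto simp: torsion_action_mult adj2_mult[OF A] torsion_action_one\<close>)

text \<open>Reducing the numerators modulo \<open>t\<close> moves the point by an integer vector, to
  which \<open>slash_abs\<close> is blind by periodicity.\<close>

lemma slash_abs_torsion_action:
  assumes t: "t > 0" and A: "A \<in> carrier SL2Z" and B: "B \<in> carrier SL2Z" and \<tau>: "Im \<tau> > 0"
  shows "slash_abs A (torsion_pt t (torsion_action t B e)) \<tau> = slash_abs A (row_action B (torsion_pt t e)) \<tau>"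
proof -
  define x y where "x = B$1$1 * fst e + B$2$1 * snd e" and "y = B$1$2 * fst e + B$2$2 * snd e"
  have *: "real_of_int z / of_int t = of_int (z mod t) / of_int t + of_int (z div t)" for z
  proof -
    have "real_of_int z = of_int (z mod t) + of_int t * of_int (z div t)"
      by (metis add.commute mult_div_mod_eq of_int_add of_int_mult)
    then show ?thesis using t by (simp add: field_simps)
  qed
  have "row_action B (torsion_pt t e) = (of_int x / of_int t, of_int y / of_int t)"
    by (simp add: row_action_def torsion_pt_def x_def y_def add_divide_distrib)
  then show ?thesis
    using slash_abs_periodic[OF A \<tau>, of "of_int (x mod t) / of_int t" "x div t" "of_int (y mod t) / of_int t" "y div t"]
    by (simp add: torsion_pt_def torsion_action_def x_def y_def flip: *)
qed

lemma bij_coset_mult: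
  assumes B: "B \<in> carrier SL2Z"
  shows "bij_betw (\<lambda>X. X #>\<^bsub>SL2Z\<^esub> B) (rcosets\<^bsub>SL2Z\<^esub> \<Gamma>) (rcosets\<^bsub>SL2Z\<^esub> \<Gamma>)"
proof -
  have maps: "X #>\<^bsub>SL2Z\<^esub> C \<in> rcosets\<^bsub>SL2Z\<^esub> \<Gamma>" and canc: "X #>\<^bsub>SL2Z\<^esub> C #>\<^bsub>SL2Z\<^esub> inv\<^bsub>SL2Z\<^esub> C = X"
    if C: "C \<in> carrier SL2Z" and X: "X \<in> rcosets\<^bsub>SL2Z\<^esub> \<Gamma>" for X C
  proof -
    obtain A where A: "A \<in> carrier SL2Z" "X = \<Gamma> #>\<^bsub>SL2Z\<^esub> A"
      using X by (auto simp: RCOSETS_def)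
    then have "X #>\<^bsub>SL2Z\<^esub> C = \<Gamma> #>\<^bsub>SL2Z\<^esub> (A \<otimes>\<^bsub>SL2Z\<^esub> C)"
      using SL2Z.coset_mult_assoc[OF \<Gamma>_sub A(1) C] by simp
    moreover have "A \<otimes>\<^bsub>SL2Z\<^esub> C \<in> carrier SL2Z" using A C by (intro SL2Z.m_closed)
    ultimately show "X #>\<^bsub>SL2Z\<^esub> C \<in> rcosets\<^bsub>SL2Z\<^esub> \<Gamma>"
      unfolding RCOSETS_def by blast
    have X: "X \<subseteq> carrier SL2Z" using A SL2Z.r_coset_subset_G[OF \<Gamma>_sub A(1)] by simp
    have "X #>\<^bsub>SL2Z\<^esub> C #>\<^bsub>SL2Z\<^esub> inv\<^bsub>SL2Z\<^esub> C = X #>\<^bsub>SL2Z\<^esub> (C \<otimes>\<^bsub>SL2Z\<^esub> inv\<^bsub>SL2Z\<^esub> C)"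
      by (rule SL2Z.coset_mult_assoc[OF X C]) (use C in simp)
    then show "X #>\<^bsub>SL2Z\<^esub> C #>\<^bsub>SL2Z\<^esub> inv\<^bsub>SL2Z\<^esub> C = X"
      using SL2Z.r_inv[OF C] SL2Z.coset_mult_one[OF X] by simp
  qed
  have B': "inv\<^bsub>SL2Z\<^esub> B \<in> carrier SL2Z" using B by simp
  show ?thesis
    by (rule bij_betw_byWitness[where f' = "\<lambda>X. X #>\<^bsub>SL2Z\<^esub> inv\<^bsub>SL2Z\<^esub> B"])
       (use maps[OF B] maps[OF B'] canc[OF B] canc[OF B'] B in auto)
qed

definition torsion_norm :: "int \<Rightarrow> complex \<Rightarrow> real" where
  "torsion_norm t \<tau> = (\<Prod>X\<in>rcosets\<^bsub>SL2Z\<^esub> \<Gamma>. \<Prod>e\<in>torsion t. slash_abs (coset_rep X) (torsion_pt t e) \<tau>)"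

text \<open>Passing from \<tau> to B\<tau> multiplies each coset by B on the right and moves each
  torsion point by B. Both maps are bijections, so the factors are merely reordered.\<close>

lemma torsion_norm_moebius:
  assumes t: "t > 0" and B: "B \<in> carrier SL2Z" and \<tau>: "Im \<tau> > 0"
  shows "torsion_norm t (moebius_int B \<tau>) = torsion_norm t \<tau>"
proof -
  have step: "slash_abs (coset_rep X) (torsion_pt t e) (moebius_int B \<tau>)
      = slash_abs (coset_rep (X #>\<^bsub>SL2Z\<^esub> B)) (torsion_pt t (torsion_action t B e)) \<tau>"
    if X: "X \<in> rcosets\<^bsub>SL2Z\<^esub> \<Gamma>" for X e
  proof -
    have A: "coset_rep X \<in> carrier SL2Z" "coset_rep X \<in> X" using coset_rep[OF X] by auto
    have AB: "coset_rep X ** B \<in> X #>\<^bsub>SL2Z\<^esub> B" using A(2) by (auto simp: r_coset_def)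
    have ABc: "coset_rep X ** B \<in> carrier SL2Z" using SL2Z.m_closed[OF A(1) B] by simp
    have "slash_abs (coset_rep X) (torsion_pt t e) (moebius_int B \<tau>)
        = slash_abs (coset_rep X ** B) (row_action B (torsion_pt t e)) \<tau>"
      using slash_abs_mult[OF A(1) B \<tau>] by simp
    also have "\<dots> = slash_abs (coset_rep X ** B) (torsion_pt t (torsion_action t B e)) \<tau>"
      using slash_abs_torsion_action[OF t ABc B \<tau>] by simp
    also have "\<dots> = slash_abs (coset_rep (X #>\<^bsub>SL2Z\<^esub> B)) (torsion_pt t (torsion_action t B e)) \<tau>"
      using slash_abs_coset_rep[OF bij_betw_apply[OF bij_coset_mult[OF B] X] AB \<tau>] by simp
    finally show ?thesis .
  qed
  have "torsion_norm t (moebius_int B \<tau>) = (\<Prod>X\<in>rcosets\<^bsub>SL2Z\<^esub> \<Gamma>. \<Prod>e\<in>torsion t.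
      slash_abs (coset_rep (X #>\<^bsub>SL2Z\<^esub> B)) (torsion_pt t (torsion_action t B e)) \<tau>)"
    unfolding torsion_norm_def by (intro prod.cong refl step)
  also have "\<dots> = (\<Prod>X\<in>rcosets\<^bsub>SL2Z\<^esub> \<Gamma>. \<Prod>e\<in>torsion t.
      slash_abs (coset_rep (X #>\<^bsub>SL2Z\<^esub> B)) (torsion_pt t e) \<tau>)"
    by (intro prod.cong refl prod.reindex_bij_betw[OF bij_torsion_action[OF t B]])
  also have "\<dots> = torsion_norm t \<tau>"
    unfolding torsion_norm_def
    by (rule prod.reindex_bij_betw[OF bij_coset_mult[OF B],
          of "\<lambda>X. \<Prod>e\<in>torsion t. slash_abs (coset_rep X) (torsion_pt t e) \<tau>"])
  finally show ?thesis .
qed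

end

section \<open>Fourier expansions\<close>

text \<open>In the variable w = exp(2 pi i \<tau> / M) the expansion is a power series with sum 0 on
  the punctured unit disc, and power series coefficients are unique.\<close>

lemma q_expansion_zero_coeff:
  assumes "q_expansion (\<lambda>\<tau> z. 0) c"
  shows "c n z = 0"
proof -
  obtain M where M: "M > 0"
    and off: "\<And>n z. n \<notin> nonneg_rats_denom M \<Longrightarrow> c n z = 0"
    and sum: "\<And>\<tau> z. Im \<tau> > 0 \<Longrightarrow>
        ((\<lambda>n. c n z * exp (2 * of_real pi * \<i> * of_rat n * \<tau>)) has_sum 0) (nonneg_rats_denom M)"
    using assms unfolding q_expansion_def by blast
  define a where "a j = c (of_nat j / of_nat M) z" for j :: nat
  have bij: "bij_betw (\<lambda>j. of_nat j / of_nat M) (UNIV :: nat set) (nonneg_rats_denom M)"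
    using M by (auto simp: bij_betw_def inj_on_def nonneg_rats_denom_def)
  have sums0: "(\<lambda>j. a j * w ^ j) sums 0" if w: "w \<noteq> 0" "cmod w < 1" for w
  proof -
    define \<tau> where "\<tau> = of_nat M * Ln w / (2 * of_real pi * \<i>)"
    have "Re (Ln w) < 0" using w by (simp add: Re_Ln)
    then have "Im \<tau> > 0"
      using M by (simp add: \<tau>_def Im_divide_of_real field_simps Im_divide zero_less_mult_iff mult_less_0_iff divide_less_0_iff)
    moreover have "exp (2 * of_real pi * \<i> * of_rat (of_nat j / of_nat M) * \<tau>) = w ^ j" for j
    proof -
      have "2 * of_real pi * \<i> * of_rat (of_nat j / of_nat M) * \<tau> = of_nat j * Ln w"
        using M by (simp add: \<tau>_def of_rat_divide)
      then show ?thesis using w by (simp add: exp_of_nat_mult)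
    qed
    ultimately have "((\<lambda>j. a j * w ^ j) has_sum 0) UNIV"
      using sum[of \<tau> z] has_sum_reindex_bij_betw[OF bij, of "\<lambda>n. c n z * exp (2 * of_real pi * \<i> * of_rat n * \<tau>)" 0]
      by (simp add: a_def)
    then show ?thesis by (rule has_sum_imp_sums)
  qed
  \<comment> \<open>No \<tau> corresponds to w = 0. Multiplying the series by w fixes the value
    there as 0, and the shifted index \<open>Suc j\<close> is positive, as
    \<open>powser_0_nonzero\<close> demands.\<close>
  define b where "b j = (case j of 0 \<Rightarrow> 0 | Suc i \<Rightarrow> a i)" for j :: nat
  have b_sums: "(\<lambda>j. b j * (w - 0) ^ j) sums 0" if "cmod (w - 0) < 1" for w
  proof (cases "w = 0")
    case True
    then have "b j * (w - 0) ^ j = 0" for j by (cases j) (auto simp: b_def)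
    then show ?thesis by (simp only: sums_zero)
  next
    case False
    then have "(\<lambda>j. w * (a j * w ^ j)) sums (w * 0)"
      using that by (intro sums_mult sums0) auto
    then have "(\<lambda>j. b (Suc j) * w ^ Suc j) sums 0"
      by (simp add: b_def mult_ac)
    then show ?thesis by (subst (asm) sums_Suc_iff) (simp add: b_def)
  qed
  have "a j = 0" for j
  proof (rule ccontr)
    assume "a j \<noteq> 0"
    then have "b (Suc j) \<noteq> 0" by (simp add: b_def)
    show False
    proof (rule powser_0_nonzero[of 1 0 b "\<lambda>_. 0" "Suc j"])
      show "(\<lambda>n. b n * (w - 0) ^ n) sums 0" if "cmod (w - 0) < 1" for w
        using that by (rule b_sums)
    next
      fix s :: real
      assume s: "0 < s" and "\<And>z. z \<in> cball (0::complex) s - {0} \<Longrightarrow> (0::complex) \<noteq> 0"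
      from this(2)[of "of_real s"] show False using s by simp
    qed (use \<open>b (Suc j) \<noteq> 0\<close> in simp_all)
  qed
  then show ?thesis
    using off by (cases "n \<in> nonneg_rats_denom M") (auto simp: a_def nonneg_rats_denom_def)
qed

lemma zero_in_jacobi_forms: "(\<lambda>\<tau> z. 0) \<in> jacobi_forms k m \<Gamma> chi"
proof -
  have "jacobi_fourier_expansion m (\<lambda>\<tau> z. 0) 1 (\<lambda>n r. 0)"
    by (simp add: jacobi_fourier_expansion_def case_prod_unfold)
  moreover have "jacobi_slash k m (\<lambda>\<tau> z. 0) A = (\<lambda>\<tau> z. 0)" for A
    by (simp add: jacobi_slash_def fun_eq_iff)
  moreover have "holomorphic2_on (\<lambda>(\<tau>, z). 0) S" for S
    unfolding holomorphic2_on_def case_prod_unfold by (intro ballI exI[of _ "\<lambda>_. 0"]) simp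
  ultimately show ?thesis
    unfolding jacobi_forms_def by (auto intro!: exI[of _ "1::nat"])
qed

text \<open>By uniqueness of coefficients no exponent of the zero form qualifies, and the infimum of
  the empty set is infinity.\<close>

lemma zero_in_jacobi_forms_vanishing: "(\<lambda>\<tau> z. 0) \<in> jacobi_forms_vanishing k m \<Gamma> chi N"
proof -
  have "{ereal (of_rat n) | n c. q_expansion (\<lambda>\<tau> z. 0) c \<and> (\<exists>z. c n z \<noteq> 0)} = {}"
    using q_expansion_zero_coeff by blast
  then have "ord_infty (\<lambda>\<tau> z. 0) = \<infinity>"
    unfolding ord_infty_def by (simp only: Inf_empty top_ereal_def)
  then show ?thesis by (simp add: jacobi_forms_vanishing_def zero_in_jacobi_forms)
qed

text \<open>The chain rule gives the real derivative h -> f'(h u', h w'); complex linearity pulls h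
  out, so it is multiplication by a complex number.\<close>

lemma holomorphic2_on_compose:
  assumes f: "holomorphic2_on f S" and u: "u holomorphic_on T" and w: "w holomorphic_on T"
    and T: "open T" and maps: "\<And>x. x \<in> T \<Longrightarrow> (u x, w x) \<in> S"
  shows "(\<lambda>x. f (u x, w x)) holomorphic_on T"
  unfolding holomorphic_on_open[OF T]
proof
  fix x assume x: "x \<in> T"
  obtain f' where f': "(f has_derivative f') (at (u x, w x))" "\<And>c a b. f' (c * a, c * b) = c * f' (a, b)"
    using f maps[OF x] by (auto simp: holomorphic2_on_def)
  have "(u has_derivative (\<lambda>h. h * deriv u x)) (at x)" "(w has_derivative (\<lambda>h. h * deriv w x)) (at x)"
    using holomorphic_derivI[OF u T x] holomorphic_derivI[OF w T x]
    unfolding has_field_derivative_def mult_commute_abs by blast+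
  then have "((\<lambda>x. (u x, w x)) has_derivative (\<lambda>h. (h * deriv u x, h * deriv w x))) (at x)"
    by (rule has_derivative_Pair)
  from diff_chain_at[OF this, of f f'] f'(1)
  have "((\<lambda>x. f (u x, w x)) has_derivative (\<lambda>h. f' (h * deriv u x, h * deriv w x))) (at x)"
    by (simp add: o_def)
  then show "\<exists>D. ((\<lambda>x. f (u x, w x)) has_field_derivative D) (at x)"
    unfolding has_field_derivative_def f'(2) mult_commute_abs by blast
qed

text \<open>At z = x\<tau> + y the term of index (n, r) has modulus |f n r| exp(-2 pi E Im \<tau>)
  with E = n + rx + mx^2. As E is at least \<kappa>, raising the height from v to Im \<tau>
  multiplies each modulus by at most exp(-2 pi \<kappa> (Im \<tau> - v)).\<close>

lemma fourier_torsion_bound: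
  assumes sum: "\<And>\<tau> z. Im \<tau> > 0 \<Longrightarrow>
      ((\<lambda>(n, r). f n r * exp (2 * of_real pi * \<i> * of_rat n * \<tau>) * exp (2 * of_real pi * \<i> * of_int r * z))
        has_sum \<psi> \<tau> z) S"
    and \<kappa>: "\<And>n r. (n, r) \<in> S \<Longrightarrow> f n r \<noteq> 0 \<Longrightarrow> \<kappa> \<le> of_rat n + of_int r * x + of_nat m * x\<^sup>2"
    and v: "v > 0"
  shows "\<exists>C. \<forall>\<tau>. Im \<tau> \<ge> v \<longrightarrow>
    cmod (exp (2 * of_real pi * \<i> * of_nat m * of_real (x\<^sup>2) * \<tau>) * \<psi> \<tau> (of_real x * \<tau> + of_real y))
      \<le> C * exp (- 2 * pi * \<kappa> * Im \<tau>)"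
proof -
  define E where "E p = of_rat (fst p) + of_int (snd p) * x + of_nat m * x\<^sup>2" for p :: "rat \<times> int"
  define F where "F p = cmod (f (fst p) (snd p))" for p
  define t where "t \<tau> p = exp (2 * of_real pi * \<i> * of_nat m * of_real (x\<^sup>2) * \<tau>) *
      (f (fst p) (snd p) * exp (2 * of_real pi * \<i> * of_rat (fst p) * \<tau>)
        * exp (2 * of_real pi * \<i> * of_int (snd p) * (of_real x * \<tau> + of_real y)))" for \<tau> p
  have t_sum: "(t \<tau> has_sum exp (2 * of_real pi * \<i> * of_nat m * of_real (x\<^sup>2) * \<tau>)
       * \<psi> \<tau> (of_real x * \<tau> + of_real y)) S" if "Im \<tau> > 0" for \<tau>
    unfolding t_def
    using has_sum_cmult_right[OF sum[OF that, of "of_real x * \<tau> + of_real y"],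
        of "exp (2 * of_real pi * \<i> * of_nat m * of_real (x\<^sup>2) * \<tau>)"]
    by (simp add: case_prod_unfold)
  have norm_t: "cmod (t \<tau> p) = F p * exp (- 2 * pi * E p * Im \<tau>)" for \<tau> p
  proof -
    obtain a b where q: "quotient_of (fst p) = (a, b)" by (cases "quotient_of (fst p)")
    have rat: "complex_of_rat (fst p) = of_real (real_of_rat (fst p))"
      by (simp add: quotient_of_div[OF q] of_rat_divide)
    have "cmod (t \<tau> p) = F p * exp (- (2 * pi * real m * x\<^sup>2 * Im \<tau>) - 2 * pi * of_rat (fst p) * Im \<tau>
        - 2 * pi * of_int (snd p) * x * Im \<tau>)"
      unfolding t_def norm_mult norm_exp_eq_Re F_def rat by (simp add: exp_diff exp_minus exp_add field_simps)
    also have "- (2 * pi * real m * x\<^sup>2 * Im \<tau>) - 2 * pi * of_rat (fst p) * Im \<tau>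
        - 2 * pi * of_int (snd p) * x * Im \<tau> = - 2 * pi * E p * Im \<tau>"
      by (simp add: E_def algebra_simps)
    finally show ?thesis .
  qed
  \<comment> \<open>The absolute series at the single point iv, finite by unconditional convergence,
    controls all greater heights.\<close>
  define C where "C = (\<Sum>\<^sub>\<infinity>p\<in>S. cmod (t (\<i> * of_real v) p)) * exp (2 * pi * \<kappa> * v)"
  have abs_sum: "(\<lambda>p. cmod (t \<tau> p)) summable_on S" if "Im \<tau> > 0" for \<tau>
    using has_sum_imp_summable[OF t_sum[OF that]] by (simp add: summable_on_iff_abs_summable_on_complex)
  have "cmod (exp (2 * of_real pi * \<i> * of_nat m * of_real (x\<^sup>2) * \<tau>) * \<psi> \<tau> (of_real x * \<tau> + of_real y))
      \<le> C * exp (- 2 * pi * \<kappa> * Im \<tau>)" if \<tau>: "Im \<tau> \<ge> v" for \<tau>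
  proof -
    have \<tau>pos: "Im \<tau> > 0" using \<tau> v by simp
    have iv: "Im (\<i> * of_real v) > 0" using v by simp
    have "cmod (exp (2 * of_real pi * \<i> * of_nat m * of_real (x\<^sup>2) * \<tau>) * \<psi> \<tau> (of_real x * \<tau> + of_real y))
      \<le> (\<Sum>\<^sub>\<infinity>p\<in>S. cmod (t \<tau> p))"
      using norm_infsum_bound[OF abs_sum[OF \<tau>pos]] infsumI[OF t_sum[OF \<tau>pos]] by simp
    also have "\<dots> \<le> (\<Sum>\<^sub>\<infinity>p\<in>S. exp (- 2 * pi * \<kappa> * (Im \<tau> - v)) * cmod (t (\<i> * of_real v) p))"
    proof (rule infsum_mono[OF abs_sum[OF \<tau>pos] summable_on_cmult_right[OF abs_sum[OF iv]]])
      fix p assume p: "p \<in> S"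
      show "cmod (t \<tau> p) \<le> exp (- 2 * pi * \<kappa> * (Im \<tau> - v)) * cmod (t (\<i> * of_real v) p)"
      proof (cases "F p = 0")
        case False
        then have "\<kappa> \<le> E p"
          using \<kappa>[of "fst p" "snd p"] p by (simp add: F_def E_def)
        then have "\<kappa> * (Im \<tau> - v) \<le> E p * (Im \<tau> - v)" using \<tau> by (intro mult_right_mono) auto
        then have "2 * pi * (\<kappa> * (Im \<tau> - v)) \<le> 2 * pi * (E p * (Im \<tau> - v))"
          by (intro mult_left_mono) auto
        then have "exp (- 2 * pi * E p * Im \<tau>) \<le> exp (- 2 * pi * \<kappa> * (Im \<tau> - v) + - 2 * pi * E p * v)"
          by (simp add: algebra_simps)
        then have "F p * exp (- 2 * pi * E p * Im \<tau>)
            \<le> F p * (exp (- 2 * pi * \<kappa> * (Im \<tau> - v)) * exp (- 2 * pi * E p * v))"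
          unfolding exp_add by (intro mult_left_mono) (auto simp: F_def)
        then show ?thesis unfolding norm_t by (simp add: mult_ac)
      qed (simp add: norm_t)
    qed
    also have "\<dots> = C * exp (- 2 * pi * \<kappa> * Im \<tau>)"
    proof -
      have "exp (- 2 * pi * \<kappa> * (Im \<tau> - v)) = exp (2 * pi * \<kappa> * v) * exp (- 2 * pi * \<kappa> * Im \<tau>)"
        unfolding exp_add[symmetric] by (simp add: algebra_simps)
      then show ?thesis
        unfolding C_def by (subst infsum_cmult_right) (use abs_sum[OF iv] in \<open>auto simp: mult_ac\<close>)
    qed
    finally show ?thesis .
  qed
  then show ?thesis by blast
qed

text \<open>Complete the square in x after multiplying by 4m.\<close>

lemma fourier_exponent_nonneg:
  fixes n x m r :: real
  assumes "4 * n * m \<ge> r\<^sup>2" "m > 0"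
  shows "0 \<le> n + r * x + m * x\<^sup>2"
proof -
  have "4 * m * (n + r * x + m * x\<^sup>2) = (4 * n * m - r\<^sup>2) + (r + 2 * m * x)\<^sup>2"
    by (simp add: power2_eq_square algebra_simps)
  also have "\<dots> \<ge> 0" using assms by simp
  finally show ?thesis using assms(2) by (simp add: zero_le_mult_iff)
qed

text \<open>From |r| \<le> 2 sqrt(nm) the exponent is at least (sqrt n - x sqrt m)^2. The condition
  on \<delta> keeps the smaller base nonnegative, so squaring preserves the order.\<close>

lemma fourier_exponent_ge:
  fixes n x m r \<delta> N :: real
  assumes rn: "4 * n * m \<ge> r\<^sup>2" and m: "m > 0" and N: "N \<le> n" "N \<ge> 0"
    and x: "0 \<le> x" "x \<le> \<delta>" and \<delta>: "\<delta> * sqrt m \<le> sqrt N"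
  shows "(sqrt N - \<delta> * sqrt m)\<^sup>2 \<le> n + r * x + m * x\<^sup>2"
proof -
  have "\<bar>r\<bar> \<le> sqrt (4 * n * m)" using rn by (metis real_sqrt_abs real_sqrt_le_mono)
  also have "\<dots> = 2 * (sqrt n * sqrt m)" by (simp add: real_sqrt_mult)
  finally have "r * x \<ge> - (2 * (sqrt n * sqrt m)) * x"
    using x by (intro mult_right_mono) auto
  then have "(sqrt n - x * sqrt m)\<^sup>2 \<le> n + r * x + m * x\<^sup>2"
    using m N by (simp add: power2_diff power_mult_distrib mult_ac)
  moreover have "(sqrt N - \<delta> * sqrt m)\<^sup>2 \<le> (sqrt n - x * sqrt m)\<^sup>2"
  proof (rule power_mono)
    have "x * sqrt m \<le> \<delta> * sqrt m" using x m by (intro mult_right_mono) auto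
    moreover have "sqrt N \<le> sqrt n" using N by simp
    ultimately show "sqrt N - \<delta> * sqrt m \<le> sqrt n - x * sqrt m" by linarith
    show "0 \<le> sqrt N - \<delta> * sqrt m" using \<delta> by simp
  qed
  ultimately show ?thesis by linarith
qed

text \<open>Summing over r first yields a q-expansion, whose coefficients below \<open>N\<close>
  vanish by the order hypothesis. This concerns sums over r, not each \<open>f n r\<close>, so the
  block of terms with n < \<open>N\<close> has sum 0 and is removed as a whole.\<close>

lemma fourier_expansion_vanishing:
  assumes exp: "jacobi_fourier_expansion m \<phi> M f" and M: "M > 0"
    and ord: "ord_infty \<phi> \<ge> ereal N" and \<tau>: "Im \<tau> > 0"
  shows "((\<lambda>(n, r). f n r * exp (2 * of_real pi * \<i> * of_rat n * \<tau>) * exp (2 * of_real pi * \<i> * of_int r * z))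
        has_sum \<phi> \<tau> z) ({n \<in> nonneg_rats_denom M. of_rat n \<ge> N} \<times> UNIV)"
proof -
  define D where "D = nonneg_rats_denom M"
  define t where "t \<tau> z = (\<lambda>(n, r). f n r * exp (2 * of_real pi * \<i> * of_rat n * \<tau>)
     * exp (2 * of_real pi * \<i> * of_int r * z))" for \<tau> z
  have sum: "(t \<tau> z has_sum \<phi> \<tau> z) (D \<times> UNIV)" if "Im \<tau> > 0" for \<tau> z
    using exp that unfolding jacobi_fourier_expansion_def D_def t_def by blast
  define c where "c n z = (if n \<in> D then \<Sum>\<^sub>\<infinity>r. f n r * exp (2 * of_real pi * \<i> * of_int r * z) else 0)" for n z
  have c_sum: "((\<lambda>r. t \<tau> z (n, r)) has_sum c n z * exp (2 * of_real pi * \<i> * of_rat n * \<tau>)) UNIV"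
    if \<tau>: "Im \<tau> > 0" and n: "n \<in> D" for \<tau> z n
  proof -
    let ?q = "exp (2 * of_real pi * \<i> * of_rat n * \<tau>)"
    have "(\<lambda>r. t \<tau> z (n, r)) summable_on UNIV"
      using has_sum_imp_summable[OF sum[OF \<tau>, of z]] n
      by (intro summable_on_SigmaD1[of "\<lambda>n r. t \<tau> z (n, r)" D "\<lambda>_. UNIV"]) auto
    then have "(\<lambda>r. inverse ?q * t \<tau> z (n, r)) summable_on UNIV"
      by (rule summable_on_cmult_right)
    moreover have "inverse ?q * t \<tau> z (n, r) = f n r * exp (2 * of_real pi * \<i> * of_int r * z)" for r
      by (simp add: t_def)
    ultimately have "(\<lambda>r. f n r * exp (2 * of_real pi * \<i> * of_int r * z)) summable_on UNIV"
      by (simp only:)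
    then have "((\<lambda>r. f n r * exp (2 * of_real pi * \<i> * of_int r * z)) has_sum c n z) UNIV"
      using n by (simp add: c_def)
    then have "((\<lambda>r. ?q * (f n r * exp (2 * of_real pi * \<i> * of_int r * z))) has_sum (?q * c n z)) UNIV"
      by (rule has_sum_cmult_right)
    then show ?thesis by (simp add: t_def mult_ac)
  qed
  have "q_expansion \<phi> c"
    unfolding q_expansion_def
  proof (intro exI[of _ M] conjI allI impI M)
    fix \<tau> z assume "0 < Im \<tau>"
    then show "((\<lambda>n. c n z * exp (2 * of_real pi * \<i> * of_rat n * \<tau>)) has_sum \<phi> \<tau> z) (nonneg_rats_denom M)"
      unfolding D_def[symmetric] using has_sum_SigmaD[OF sum c_sum] by blast
  qed (simp add: c_def D_def)
  have c0: "c n z = 0" if "of_rat n < N" for n z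
  proof (rule ccontr)
    assume "c n z \<noteq> 0"
    with \<open>q_expansion \<phi> c\<close> have "ord_infty \<phi> \<le> ereal (of_rat n)"
      unfolding ord_infty_def by (intro Inf_lower) blast
    with ord have "ereal N \<le> ereal (of_rat n)" by (rule order_trans)
    with that show False by simp
  qed
  define D' where "D' = {n \<in> D. of_rat n < N}"
  have D': "D' \<subseteq> D" by (auto simp: D'_def)
  have "t \<tau> z summable_on (D' \<times> UNIV)"
    using D' by (intro summable_on_subset_banach[OF has_sum_imp_summable[OF sum[OF \<tau>, of z]]] Sigma_mono) auto
  then obtain s where s: "(t \<tau> z has_sum s) (D' \<times> UNIV)" by (auto simp: summable_on_def)
  have "((\<lambda>n. c n z * exp (2 * of_real pi * \<i> * of_rat n * \<tau>)) has_sum s) D'"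
    using D' by (intro has_sum_SigmaD[OF s] c_sum \<tau>) auto
  moreover have "((\<lambda>n. c n z * exp (2 * of_real pi * \<i> * of_rat n * \<tau>)) has_sum 0) D'"
    using c0 by (intro has_sum_0) (auto simp: D'_def)
  ultimately have "s = 0" by (rule has_sum_unique)
  with s have "(t \<tau> z has_sum (\<phi> \<tau> z - 0)) (D \<times> UNIV - D' \<times> UNIV)"
    using D' by (intro has_sum_Diff sum \<tau>) auto
  also have "D \<times> UNIV - D' \<times> UNIV = {n \<in> D. of_rat n \<ge> N} \<times> UNIV"
    by (auto simp: D'_def)
  finally show ?thesis by (simp add: t_def D_def)
qed

section \<open>Products over torsion points\<close>

text \<open>A substitute for order at least \<kappa> at infinity, for real \<kappa>. As a bound on
  every half-plane Im \<tau> \<ge> v it is additive over products without expanding them in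
  q.\<close>

definition cusp_decay :: "real \<Rightarrow> (complex \<Rightarrow> complex) \<Rightarrow> bool" where
  "cusp_decay \<kappa> g \<longleftrightarrow> (\<forall>v>0. \<exists>C. \<forall>\<tau>. Im \<tau> \<ge> v \<longrightarrow> cmod (g \<tau>) \<le> C * exp (- 2 * pi * \<kappa> * Im \<tau>))"

lemma cusp_decay_mult:
  assumes "cusp_decay a f" "cusp_decay b g"
  shows "cusp_decay (a + b) (\<lambda>\<tau>. f \<tau> * g \<tau>)"
  unfolding cusp_decay_def
proof (intro allI impI)
  fix v :: real assume "v > 0"
  with assms obtain C D where
    C: "\<And>\<tau>. Im \<tau> \<ge> v \<Longrightarrow> cmod (f \<tau>) \<le> C * exp (- 2 * pi * a * Im \<tau>)" and
    D: "\<And>\<tau>. Im \<tau> \<ge> v \<Longrightarrow> cmod (g \<tau>) \<le> D * exp (- 2 * pi * b * Im \<tau>)"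
    unfolding cusp_decay_def by meson
  have "cmod (f \<tau> * g \<tau>) \<le> (C * D) * exp (- 2 * pi * (a + b) * Im \<tau>)" if "Im \<tau> \<ge> v" for \<tau>
  proof -
    have "cmod (f \<tau> * g \<tau>) \<le> (C * exp (- 2 * pi * a * Im \<tau>)) * (D * exp (- 2 * pi * b * Im \<tau>))"
      unfolding norm_mult using C[OF that] D[OF that] by (intro mult_mono) (auto intro: order_trans[OF norm_ge_zero])
    also have "\<dots> = (C * D) * (exp (- 2 * pi * a * Im \<tau>) * exp (- 2 * pi * b * Im \<tau>))"
      by simp
    also have "\<dots> = (C * D) * exp (- 2 * pi * (a + b) * Im \<tau>)"
      unfolding exp_add[symmetric] by (simp add: algebra_simps)
    finally show ?thesis .
  qed
  then show "\<exists>C. \<forall>\<tau>. v \<le> Im \<tau> \<longrightarrow> cmod (f \<tau> * g \<tau>) \<le> C * exp (- 2 * pi * (a + b) * Im \<tau>)" by blast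
qed

lemma cusp_decay_prod:
  assumes "finite I" "\<And>i. i \<in> I \<Longrightarrow> cusp_decay (\<kappa> i) (g i)"
  shows "cusp_decay (\<Sum>i\<in>I. \<kappa> i) (\<lambda>\<tau>. \<Prod>i\<in>I. g i \<tau>)"
  using assms
proof (induction I rule: finite_induct)
  case empty
  then show ?case by (auto simp: cusp_decay_def intro: exI[of _ 1])
qed (simp add: cusp_decay_mult)

text \<open>Holomorphic functions on a connected open set have no zero divisors: where the partial
  product is nonzero, an open set, the next factor would vanish, hence everywhere.\<close>

lemma holomorphic_prod_nonzero:
  assumes "finite I" and S: "open S" "connected S" "S \<noteq> {}"
    and hol: "\<And>i. i \<in> I \<Longrightarrow> g i holomorphic_on S"
    and nz: "\<And>i. i \<in> I \<Longrightarrow> \<exists>z\<in>S. g i z \<noteq> 0"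
  shows "\<exists>z\<in>S. (\<Prod>i\<in>I. g i z) \<noteq> 0"
  using assms(1) hol nz
proof (induction I rule: finite_induct)
  case empty
  then show ?case using S(3) by auto
next
  case (insert i I)
  define P where "P z = (\<Prod>j\<in>I. g j z)" for z
  have contP: "continuous_on S P"
    unfolding P_def using insert.prems(1)
    by (intro holomorphic_on_imp_continuous_on holomorphic_on_prod) auto
  have "\<exists>z\<in>S. P z \<noteq> 0" unfolding P_def using insert by simp
  define U where "U = S \<inter> P -` (- {0})"
  have "open U" unfolding U_def using contP S(1) by (intro continuous_open_preimage) auto
  have "U \<noteq> {}" using \<open>\<exists>z\<in>S. P z \<noteq> 0\<close> by (auto simp: U_def)
  show ?case
  proof (rule ccontr)
    assume "\<not> ?thesis"
    then have "g i z = 0" if "z \<in> U" for z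
      using that insert.hyps by (auto simp: U_def P_def)
    then have "g i z = 0" if "z \<in> S" for z
      using analytic_continuation_open[OF \<open>open U\<close> S(1) \<open>U \<noteq> {}\<close> S(2), of "g i" "\<lambda>_. 0" z] that insert.prems(1)
      by (auto simp: U_def)
    then show False using insert.prems(2) by blast
  qed
qed

lemma open_upper_half_plane: "open upper_half_plane"
  and connected_upper_half_plane: "connected upper_half_plane"
  by (simp_all add: open_halfspace_Im_gt convex_connected convex_halfspace_Im_gt)

section \<open>Holomorphy, decay and nonvanishing of the factors\<close>

context jacobi_form
begin

definition torsion_factor :: "int^2^2 \<Rightarrow> real \<times> real \<Rightarrow> complex \<Rightarrow> complex" where
  "torsion_factor A p \<tau> = exp (2 * of_real pi * \<i> * of_nat m * of_real ((fst p)\<^sup>2) * \<tau>)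
     * jacobi_slash k m \<phi> A \<tau> (of_real (fst p) * \<tau> + of_real (snd p))"

lemma slash_abs_eq: "slash_abs A p \<tau> = Im \<tau> powr (real k / 2) * cmod (torsion_factor A p \<tau>)"
  by (simp add: slash_abs_def jacobi_norm_def torsion_factor_def)

lemma torsion_factor_holomorphic:
  assumes A: "A \<in> carrier SL2Z"
  shows "torsion_factor A p holomorphic_on upper_half_plane"
proof -
  have hol: "holomorphic2_on (\<lambda>(\<tau>, z). \<phi> \<tau> z) (upper_half_plane \<times> UNIV)"
    using form by (simp add: jacobi_forms_def)
  have nz: "of_int (A$2$1) * \<tau> + of_int (A$2$2) \<noteq> 0" if "Im \<tau> > 0" for \<tau>
    using moebius_denom_nonzero[OF A that] by (simp add: moebius_denom_def)
  have "(\<lambda>\<tau>. (\<lambda>(\<tau>, z). \<phi> \<tau> z) ((of_int (A$1$1) * \<tau> + of_int (A$1$2)) / (of_int (A$2$1) * \<tau> + of_int (A$2$2)),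
      (of_real (fst p) * \<tau> + of_real (snd p)) / (of_int (A$2$1) * \<tau> + of_int (A$2$2))))
    holomorphic_on upper_half_plane"
  proof (rule holomorphic2_on_compose[OF hol _ _ open_upper_half_plane])
    show "((of_int (A$1$1) * \<tau> + of_int (A$1$2)) / (of_int (A$2$1) * \<tau> + of_int (A$2$2)),
      (of_real (fst p) * \<tau> + of_real (snd p)) / (of_int (A$2$1) * \<tau> + of_int (A$2$2)))
      \<in> upper_half_plane \<times> UNIV" if "\<tau> \<in> upper_half_plane" for \<tau>
      using Im_moebius_int_pos[OF A] that by (simp add: moebius_int_def moebius_denom_def)
  qed (use nz in \<open>auto intro!: holomorphic_intros\<close>)
  then show ?thesis
    unfolding torsion_factor_def jacobi_slash_def Let_def
    using nz by (auto intro!: holomorphic_intros)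
qed

lemma torsion_factor_decay:
  assumes m: "m > 0" and A: "A \<in> carrier SL2Z"
  shows "cusp_decay 0 (torsion_factor A p)"
proof -
  obtain M f where "M > 0" and f: "jacobi_fourier_expansion m (jacobi_slash k m \<phi> A) M f"
    using form A by (auto simp: jacobi_forms_def)
  have "0 \<le> of_rat n + of_int r * fst p + of_nat m * (fst p)\<^sup>2"
    if "n \<in> nonneg_rats_denom M" "f n r \<noteq> 0" for n r
  proof (rule fourier_exponent_nonneg)
    have "real_of_rat ((of_int r)\<^sup>2) \<le> real_of_rat (4 * n * of_nat m)"
      using f that unfolding jacobi_fourier_expansion_def of_rat_less_eq by blast
    then show "(of_int r)\<^sup>2 \<le> 4 * real_of_rat n * of_nat m"
      by (simp add: of_rat_mult of_rat_power)
  qed (use m in simp)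
  then have "\<exists>C. \<forall>\<tau>. Im \<tau> \<ge> v \<longrightarrow>
      cmod (exp (2 * of_real pi * \<i> * of_nat m * of_real ((fst p)\<^sup>2) * \<tau>)
        * jacobi_slash k m \<phi> A \<tau> (of_real (fst p) * \<tau> + of_real (snd p)))
      \<le> C * exp (- 2 * pi * 0 * Im \<tau>)" if "v > 0" for v
    using f that by (intro fourier_torsion_bound[of f "nonneg_rats_denom M \<times> UNIV"])
      (auto simp: jacobi_fourier_expansion_def)
  then show ?thesis unfolding cusp_decay_def torsion_factor_def by blast
qed

text \<open>The order hypothesis concerns \<phi> at infinity, so only the identity matrix gains; the
  series restricted to n \<ge> \<open>N\<close> supplies the exponent bound.\<close>

lemma torsion_factor_decay_infinity:
  assumes m: "m > 0" and N: "N \<ge> 0" and ord: "ord_infty \<phi> \<ge> ereal N"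
    and p: "0 \<le> fst p" "fst p \<le> \<delta>" and \<delta>: "\<delta> * sqrt m \<le> sqrt N"
  shows "cusp_decay ((sqrt N - \<delta> * sqrt m)\<^sup>2) (torsion_factor (mat 1) p)"
proof -
  have one: "mat 1 \<in> carrier SL2Z" using SL2Z.one_closed by simp
  have "\<exists>M>0. \<exists>f. jacobi_fourier_expansion m (jacobi_slash k m \<phi> (mat 1)) M f"
    using form one unfolding jacobi_forms_def by blast
  then obtain M f where M: "M > 0" and f: "jacobi_fourier_expansion m \<phi> M f"
    unfolding jacobi_slash_one by blast
  have "(sqrt N - \<delta> * sqrt m)\<^sup>2 \<le> of_rat n + of_int r * fst p + of_nat m * (fst p)\<^sup>2"
    if "n \<in> nonneg_rats_denom M" "of_rat n \<ge> N" "f n r \<noteq> 0" for n r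
  proof (rule fourier_exponent_ge[OF _ _ _ N p \<delta>])
    have "real_of_rat ((of_int r)\<^sup>2) \<le> real_of_rat (4 * n * of_nat m)"
      using f that unfolding jacobi_fourier_expansion_def of_rat_less_eq by blast
    then show "(of_int r)\<^sup>2 \<le> 4 * real_of_rat n * of_nat m"
      by (simp add: of_rat_mult of_rat_power)
  qed (use m that in simp_all)
  then have "\<exists>C. \<forall>\<tau>. Im \<tau> \<ge> v \<longrightarrow>
      cmod (exp (2 * of_real pi * \<i> * of_nat m * of_real ((fst p)\<^sup>2) * \<tau>)
        * \<phi> \<tau> (of_real (fst p) * \<tau> + of_real (snd p)))
      \<le> C * exp (- 2 * pi * (sqrt N - \<delta> * sqrt m)\<^sup>2 * Im \<tau>)" if "v > 0" for v
    using that fourier_expansion_vanishing[OF f M ord]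
    by (intro fourier_torsion_bound[of f "{n \<in> nonneg_rats_denom M. of_rat n \<ge> N} \<times> UNIV"]) auto
  then show ?thesis unfolding cusp_decay_def torsion_factor_def jacobi_slash_one by blast
qed

lemma \<Gamma>_in_rcosets: "\<Gamma> \<in> rcosets\<^bsub>SL2Z\<^esub> \<Gamma>"
  and one_in_\<Gamma>: "mat 1 \<in> \<Gamma>"
  using subgroup.one_closed[OF \<Gamma>_subgroup] SL2Z.coset_mult_one[OF \<Gamma>_sub] SL2Z.one_closed
  by (auto simp: RCOSETS_def)

text \<open>The chosen representative of the trivial coset need not be the identity, but the two
  factors have equal modulus.\<close>

lemma torsion_factor_decay_coset_rep:
  assumes "cusp_decay \<kappa> (torsion_factor (mat 1) p)"
  shows "cusp_decay \<kappa> (torsion_factor (coset_rep \<Gamma>) p)"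
proof -
  have "cmod (torsion_factor (coset_rep \<Gamma>) p \<tau>) = cmod (torsion_factor (mat 1) p \<tau>)" if "Im \<tau> > 0" for \<tau>
    using slash_abs_coset_rep[OF \<Gamma>_in_rcosets one_in_\<Gamma> that, of p] that by (simp add: slash_abs_eq)
  then have "cmod (torsion_factor (coset_rep \<Gamma>) p \<tau>) = cmod (torsion_factor (mat 1) p \<tau>)"
    if "v > 0" "v \<le> Im \<tau>" for v \<tau> using that by (meson less_le_trans)
  then show ?thesis
    using assms unfolding cusp_decay_def by auto
qed

text \<open>Two torsion points of different prime orders are distinct, so a finite set of points
  excludes only finitely many primes.\<close>

lemma exists_good_prime:
  assumes \<tau>0: "Im \<tau>\<^sub>0 > 0" and nz: "\<phi> \<tau>\<^sub>0 z\<^sub>0 \<noteq> 0"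
  obtains q :: nat where "prime q" "q > B"
    "\<And>e. e \<in> torsion (int q) \<Longrightarrow> slash_abs (mat 1) (torsion_pt (int q) e) \<tau>\<^sub>0 \<noteq> 0"
proof -
  have hol2: "holomorphic2_on (\<lambda>(\<tau>, z). \<phi> \<tau> z) (upper_half_plane \<times> UNIV)"
    using form by (simp add: jacobi_forms_def)
  have hol: "\<phi> \<tau>\<^sub>0 holomorphic_on UNIV"
    using holomorphic2_on_compose[OF hol2, of "\<lambda>_. \<tau>\<^sub>0" UNIV "\<lambda>z. z"] \<tau>0 by simp
  define pt where "pt p = of_real (fst p) * \<tau>\<^sub>0 + complex_of_real (snd p)" for p
  \<comment> \<open>This parallelogram contains all torsion points in question, and the entire
    function \<open>\<phi> \<tau>\<^sub>0\<close>, being nonzero at \<open>z\<^sub>0\<close>, has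
    finitely many zeros in it.\<close>
  define K where "K = pt ` ({0..1} \<times> {0..1})"
  have "compact K" unfolding K_def pt_def
    by (intro compact_continuous_image continuous_intros compact_Times) auto
  have fin: "finite {z \<in> K. \<phi> \<tau>\<^sub>0 z = 0}"
  proof (cases "\<phi> \<tau>\<^sub>0 constant_on UNIV")
    case True
    then have "{z \<in> K. \<phi> \<tau>\<^sub>0 z = 0} = {}" using nz by (auto simp: constant_on_def)
    then show ?thesis by (simp only: finite.emptyI)
  next
    case False
    then show ?thesis
      using holomorphic_compact_finite_zeros[OF hol _ _ \<open>compact K\<close>] connected_UNIV by simp
  qed
  have pt_inj: "fst p = fst p' \<and> snd p = snd p'" if "pt p = pt p'" for p p'
  proof -
    have "Im (pt p) = Im (pt p')" "Re (pt p) = Re (pt p')" using that by simp_all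
    then show ?thesis using \<tau>0 by (auto simp: pt_def)
  qed
  have slash_abs_zero: "slash_abs (mat 1) p \<tau>\<^sub>0 = 0 \<longleftrightarrow> \<phi> \<tau>\<^sub>0 (pt p) = 0" for p
    using \<tau>0 by (simp add: slash_abs_def jacobi_norm_def jacobi_slash_one pt_def)
  define bad where "bad = {q :: nat. prime q \<and> (\<exists>e\<in>torsion (int q). \<phi> \<tau>\<^sub>0 (pt (torsion_pt (int q) e)) = 0)}"
  define sel where "sel q = (SOME e. e \<in> torsion (int q) \<and> \<phi> \<tau>\<^sub>0 (pt (torsion_pt (int q) e)) = 0)" for q
  have sel: "sel q \<in> torsion (int q)" "\<phi> \<tau>\<^sub>0 (pt (torsion_pt (int q) (sel q))) = 0" if "q \<in> bad" for q
    using someI_ex[of "\<lambda>e. e \<in> torsion (int q) \<and> \<phi> \<tau>\<^sub>0 (pt (torsion_pt (int q) e)) = 0"] that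
    unfolding bad_def sel_def by blast+
  \<comment> \<open>Clearing denominators in a/q = a'/q' shows that q divides a q'; since 0 < a < q,
    it divides q'.\<close>
  have coord: "q = q'" if "prime q" "prime q'" "0 < a" "a < int q"
    "real_of_int a / of_int (int q) = of_int a' / of_int (int q')" for q q' :: nat and a a'
  proof -
    have pos: "q > 0" "q' > 0" using that(1,2) by (auto intro: prime_gt_0_nat)
    have "real_of_int (a * int q') = of_int (a' * int q)"
      using that(5) pos by (simp add: field_simps)
    then have "a * int q' = a' * int q" by (simp only: of_int_eq_iff)
    then have "int q dvd a * int q'" by simp
    then have "int q dvd a \<or> int q dvd int q'"
      using that(1) by (simp add: prime_dvd_mult_iff)
    moreover have "\<not> int q dvd a" using that(3,4) zdvd_not_zless by blast
    ultimately have "q dvd q'" by simp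
    then show ?thesis using that(1,2) primes_dvd_imp_eq by blast
  qed
  have inj: "inj_on (\<lambda>q. pt (torsion_pt (int q) (sel q))) bad"
  proof (rule inj_onI)
    fix q q' assume q: "q \<in> bad" and q': "q' \<in> bad"
      and "pt (torsion_pt (int q) (sel q)) = pt (torsion_pt (int q') (sel q'))"
    then have eq: "real_of_int (fst (sel q)) / of_int (int q) = of_int (fst (sel q')) / of_int (int q')"
        "real_of_int (snd (sel q)) / of_int (int q) = of_int (snd (sel q')) / of_int (int q')"
      using pt_inj unfolding torsion_pt_def by fastforce+
    have pr: "prime q" "prime q'" using q q' by (auto simp: bad_def)
    have "0 < fst (sel q) \<and> fst (sel q) < int q \<or> 0 < snd (sel q) \<and> snd (sel q) < int q"
      using sel(1)[OF q] by (cases "sel q") (auto simp: torsion_def)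
    then show "q = q'" using coord[OF pr] eq by blast
  qed
  have "(\<lambda>q. pt (torsion_pt (int q) (sel q))) ` bad \<subseteq> {z \<in> K. \<phi> \<tau>\<^sub>0 z = 0}"
  proof
    fix z assume "z \<in> (\<lambda>q. pt (torsion_pt (int q) (sel q))) ` bad"
    then obtain q where q: "q \<in> bad" "z = pt (torsion_pt (int q) (sel q))" by blast
    have "torsion_pt (int q) (sel q) \<in> {0..1} \<times> {0..1}"
      using sel(1)[OF q(1)] by (cases "sel q") (auto simp: torsion_def torsion_pt_def divide_le_eq_1)
    then show "z \<in> {z \<in> K. \<phi> \<tau>\<^sub>0 z = 0}" using q sel(2)[OF q(1)] by (auto simp: K_def)
  qed
  then have "finite bad" using fin inj by (meson finite_imageD finite_subset)
  then have "infinite ({q :: nat. prime q} - bad)"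
    using primes_infinite by (intro Diff_infinite_finite)
  then obtain q where "q > B" "q \<in> {q. prime q} - bad"
    unfolding infinite_nat_iff_unbounded by blast
  then show ?thesis using that[of q] by (auto simp: bad_def slash_abs_zero)
qed

text \<open>The factor of A at e is evaluated at the preimage of \<open>\<tau>\<^sub>0\<close> under
  A. There its modulus comes from the identity matrix at \<open>\<tau>\<^sub>0\<close> and another
  torsion point, which \<open>good\<close> covers.\<close>

lemma torsion_factor_nonzero:
  assumes t: "t > 0" and A: "A \<in> carrier SL2Z" and \<tau>0: "Im \<tau>\<^sub>0 > 0" and e: "e \<in> torsion t"
    and good: "\<And>e. e \<in> torsion t \<Longrightarrow> slash_abs (mat 1) (torsion_pt t e) \<tau>\<^sub>0 \<noteq> 0"
  shows "\<exists>\<tau>\<in>upper_half_plane. torsion_factor A (torsion_pt t e) \<tau> \<noteq> 0"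
proof -
  define e' where "e' = torsion_action t (adj2 A) e"
  have e': "e' \<in> torsion t" "torsion_action t A e' = e"
    unfolding e'_def using torsion_action_in[OF t adj2_in_SL2Z[OF A] e]
    by (simp_all add: torsion_action_mult adj2_mult[OF A] torsion_action_one[OF e])
  define \<tau> where "\<tau> = moebius_int (adj2 A) \<tau>\<^sub>0"
  have \<tau>: "Im \<tau> > 0" unfolding \<tau>_def by (rule Im_moebius_int_pos[OF adj2_in_SL2Z[OF A] \<tau>0])
  have "moebius_int A \<tau> = moebius_int (A ** adj2 A) \<tau>\<^sub>0"
    unfolding \<tau>_def using moebius_int_mult[OF A adj2_in_SL2Z[OF A] \<tau>0] by simp
  also have "\<dots> = \<tau>\<^sub>0" by (simp add: adj2_mult[OF A] moebius_int_def moebius_denom_def mat_one_nth)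
  finally have "slash_abs A (torsion_pt t e) \<tau> = slash_abs (mat 1) (torsion_pt t e') \<tau>\<^sub>0"
    using slash_abs_torsion_action[OF t A A \<tau>, of e'] slash_abs_row_action[OF A \<tau>] e'(2) by simp
  then have "slash_abs A (torsion_pt t e) \<tau> \<noteq> 0" using good[OF e'(1)] by simp
  then show ?thesis using \<tau> by (auto simp: slash_abs_eq)
qed

section \<open>Counting torsion points and the vanishing criterion\<close>

lemma card_torsion:
  assumes "t > 0"
  shows "real (card (torsion t)) = (of_int t)\<^sup>2 - 1"
proof -
  have "card (torsion t) = nat t * nat t - 1"
    unfolding torsion_def using assms by (subst card_Diff_subset) (auto simp: card_cartesian_product)
  moreover have "nat t * nat t \<ge> 1" using assms by simp
  ultimately show ?thesis using assms by (simp add: of_nat_diff power2_eq_square)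
qed

text \<open>The first coordinates 0, ..., floor(\<delta>t) give floor(\<delta>t) + 1 \<ge> \<delta>t
  columns of t points; the origin costs 1. The bound \<delta> < 1 keeps all these columns below
  t.\<close>

lemma card_torsion_near_zero:
  assumes t: "t > 0" and \<delta>: "0 \<le> \<delta>" "\<delta> < 1"
  shows "real (card {e \<in> torsion t. real_of_int (fst e) \<le> \<delta> * of_int t}) \<ge> \<delta> * (of_int t)\<^sup>2 - 1"
proof -
  define s where "s = \<lfloor>\<delta> * of_int t\<rfloor>"
  have s0: "s \<ge> 0" using \<delta> t by (simp add: s_def)
  have "\<delta> * of_int t < 1 * of_int t" using \<delta> t by (intro mult_strict_right_mono) auto
  then have st: "s < t" unfolding s_def by linarith
  have "{0..s} \<times> {0..<t} - {(0, 0)} \<subseteq> {e \<in> torsion t. real_of_int (fst e) \<le> \<delta> * of_int t}"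
  proof -
    have "real_of_int a \<le> \<delta> * of_int t" if "a \<le> s" for a
      using that unfolding s_def by linarith
    then show ?thesis using st by (auto simp: torsion_def)
  qed
  then have "card ({0..s} \<times> {0..<t} - {(0, 0)}) \<le> card {e \<in> torsion t. real_of_int (fst e) \<le> \<delta> * of_int t}"
    by (intro card_mono) auto
  moreover have "card ({0..s} \<times> {0..<t} - {(0, 0)}) = nat (s + 1) * nat t - 1"
    using t s0 by (subst card_Diff_subset) (auto simp: card_cartesian_product)
  moreover have "real (nat (s + 1) * nat t - 1) \<ge> \<delta> * (of_int t)\<^sup>2 - 1"
  proof -
    have "\<delta> * of_int t \<le> real_of_int (s + 1)" unfolding s_def by linarith
    then have "\<delta> * of_int t * of_int t \<le> real_of_int (s + 1) * of_int t"
      using t by (intro mult_right_mono) auto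
    moreover have "real (nat (s + 1) * nat t) = real_of_int (s + 1) * of_int t"
      using s0 t by simp
    moreover have "real n - 1 \<le> real (n - 1)" for n by (cases n) auto
    from this[of "nat (s + 1) * nat t"] have "real (nat (s + 1) * nat t) - 1 \<le> real (nat (s + 1) * nat t - 1)" .
    ultimately show ?thesis unfolding power2_eq_square mult.assoc by linarith
  qed
  ultimately show ?thesis by linarith
qed

text \<open>Finiteness matters here, since \<open>card\<close> of an infinite set is 0.\<close>

lemma index_pos: "SL2Z_index \<Gamma> > 0"
  using finite_index_congruence_subgroup[OF congruence] \<Gamma>_in_rcosets
  by (auto simp: SL2Z_index_def card_gt_0_iff)

text \<open>The product H has order at least \<open>n\<^sub>1\<close> (\<delta>q^2 - 1), while the
  threshold for its weight is w (q^2 - 1). As \<delta> \<open>n\<^sub>1\<close> > w, a large prime q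
  forces H = 0, although for a good prime no factor vanishes identically.\<close>

lemma vanishing_criterion:
  assumes m: "m > 0" and N: "N \<ge> 0" and ord: "ord_infty \<phi> \<ge> ereal N"
    and \<delta>: "0 \<le> \<delta>" "\<delta> < 1" "\<delta> * sqrt m \<le> sqrt N"
    and large: "\<delta> * (sqrt N - \<delta> * sqrt m)\<^sup>2 > real k * real (SL2Z_index \<Gamma>) / (2 * pi * sqrt 3)"
    and \<tau>0: "Im \<tau>\<^sub>0 > 0"
  shows "\<phi> \<tau>\<^sub>0 z\<^sub>0 = 0"
proof (rule ccontr)
  assume nz: "\<phi> \<tau>\<^sub>0 z\<^sub>0 \<noteq> 0"
  define R where "R = rcosets\<^bsub>SL2Z\<^esub> \<Gamma>"
  have finR: "finite R" unfolding R_def by (rule finite_index_congruence_subgroup[OF congruence])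
  define n\<^sub>1 where "n\<^sub>1 = (sqrt N - \<delta> * sqrt m)\<^sup>2"
  define w where "w = real k * real (SL2Z_index \<Gamma>) / (2 * pi * sqrt 3)"
  have w0: "w \<ge> 0" by (simp add: w_def)
  have gap: "\<delta> * n\<^sub>1 - w > 0" using large by (simp add: n\<^sub>1_def w_def)
  \<comment> \<open>For q beyond this bound, the gain (\<delta> \<open>n\<^sub>1\<close> - w) q^2
    exceeds the \<open>n\<^sub>1\<close> lost to the removed origin.\<close>
  define B where "B = nat \<lceil>n\<^sub>1 / (\<delta> * n\<^sub>1 - w)\<rceil>"
  obtain q :: nat where q: "prime q" "q > B"
    and good: "\<And>e. e \<in> torsion (int q) \<Longrightarrow> slash_abs (mat 1) (torsion_pt (int q) e) \<tau>\<^sub>0 \<noteq> 0"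
    using exists_good_prime[OF \<tau>0 nz] by blast
  define t where "t = int q"
  have t: "t > 0" using q(1) by (simp add: t_def prime_gt_0_nat)
  define H where "H \<tau> = (\<Prod>X\<in>R. \<Prod>e\<in>torsion t. torsion_factor (coset_rep X) (torsion_pt t e) \<tau>)" for \<tau>
  have rep: "coset_rep X \<in> carrier SL2Z" if "X \<in> R" for X
    using coset_rep(2) that by (simp add: R_def)
  have H_hol: "H holomorphic_on upper_half_plane"
    unfolding H_def by (intro holomorphic_on_prod torsion_factor_holomorphic rep)
  define W where "W = real k * real (card R) * real (card (torsion t))"
  have norm_H: "torsion_norm t \<tau> = cmod (H \<tau>) * Im \<tau> powr (W / 2)" if "Im \<tau> > 0" for \<tau>
  proof -
    have pw: "(Im \<tau> powr a) ^ n = Im \<tau> powr (a * real n)" for a n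
      using that by (simp add: powr_power mult.commute)
    have "torsion_norm t \<tau> = (\<Prod>X\<in>R. \<Prod>e\<in>torsion t. Im \<tau> powr (real k / 2)) * cmod (H \<tau>)"
      unfolding torsion_norm_def H_def R_def slash_abs_eq prod.distrib prod_norm[symmetric] ..
    also have "(\<Prod>X\<in>R. \<Prod>e\<in>torsion t. Im \<tau> powr (real k / 2)) = Im \<tau> powr (W / 2)"
      by (simp add: pw W_def mult_ac)
    finally show ?thesis by simp
  qed
  have H_inv: "cmod (H (moebius_int A \<tau>)) * Im (moebius_int A \<tau>) powr (W / 2) = cmod (H \<tau>) * Im \<tau> powr (W / 2)"
    if "A \<in> carrier SL2Z" "Im \<tau> > 0" for A \<tau>
    using torsion_norm_moebius[OF t that] that by (simp add: norm_H Im_moebius_int_pos)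
  define near where "near = {e \<in> torsion t. real_of_int (fst e) \<le> \<delta> * of_int t}"
  define \<kappa> where "\<kappa> X e = (if X = \<Gamma> \<and> e \<in> near then n\<^sub>1 else 0)" for X e
  have decay: "cusp_decay (\<kappa> X e) (torsion_factor (coset_rep X) (torsion_pt t e))"
    if X: "X \<in> R" and e: "e \<in> torsion t" for X e
  proof (cases "X = \<Gamma> \<and> e \<in> near")
    case True
    have "0 \<le> fst (torsion_pt t e)" "fst (torsion_pt t e) \<le> \<delta>"
      using e t True by (auto simp: torsion_pt_def torsion_def near_def field_simps)
    then have "cusp_decay n\<^sub>1 (torsion_factor (mat 1) (torsion_pt t e))"
      unfolding n\<^sub>1_def by (intro torsion_factor_decay_infinity m N ord \<delta>)
    then show ?thesis using True torsion_factor_decay_coset_rep by (simp add: \<kappa>_def)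
  next
    case False
    then show ?thesis using torsion_factor_decay[OF m rep[OF X]] by (auto simp: \<kappa>_def)
  qed
  have "cusp_decay (\<Sum>X\<in>R. \<Sum>e\<in>torsion t. \<kappa> X e) H"
    unfolding H_def using decay finR by (intro cusp_decay_prod finite_torsion)
  moreover have "(\<Sum>X\<in>R. \<Sum>e\<in>torsion t. \<kappa> X e) = n\<^sub>1 * real (card near)"
  proof -
    have "(\<Sum>e\<in>torsion t. \<kappa> X e) = (if X = \<Gamma> then n\<^sub>1 * real (card near) else 0)" for X
    proof -
      have "torsion t \<inter> near = near" by (auto simp: near_def)
      then show ?thesis by (simp add: \<kappa>_def sum.If_cases)
    qed
    then show ?thesis using finR \<Gamma>_in_rcosets by (simp add: R_def)
  qed
  ultimately have H_decay: "cusp_decay (n\<^sub>1 * real (card near)) H" by simp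
  have "n\<^sub>1 * real (card near) > W / (2 * pi * sqrt 3)"
  proof -
    have "n\<^sub>1 / (\<delta> * n\<^sub>1 - w) < real q" using q(2) unfolding B_def by linarith
    also have "real q \<le> (real q)\<^sup>2" using q(1) prime_ge_1_nat[of q] by (simp add: power2_eq_square)
    finally have "n\<^sub>1 < (\<delta> * n\<^sub>1 - w) * (real q)\<^sup>2" using gap by (simp add: field_simps)
    then have "w * (real q)\<^sup>2 < n\<^sub>1 * (\<delta> * (real q)\<^sup>2 - 1)" by (simp add: algebra_simps)
    also have "\<dots> \<le> n\<^sub>1 * real (card near)"
      using card_torsion_near_zero[OF t \<delta>(1,2)] by (intro mult_left_mono) (auto simp: near_def n\<^sub>1_def t_def)
    finally have "w * (real q)\<^sup>2 < n\<^sub>1 * real (card near)" .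
    moreover have "W / (2 * pi * sqrt 3) = w * ((real q)\<^sup>2 - 1)"
      unfolding W_def w_def card_torsion[OF t] by (simp add: t_def R_def SL2Z_index_def)
    ultimately show ?thesis using w0 by (simp add: algebra_simps)
  qed
  then have H0: "H \<tau> = 0" if "Im \<tau> > 0" for \<tau>
    using H_decay that
    by (intro moebius_invariant_vanishing[OF H_hol H_inv, of "n\<^sub>1 * real (card near)"])
       (auto simp: cusp_decay_def W_def)
  \<comment> \<open>Indexing by pairs turns the double product into a single one, to which
    \<open>holomorphic_prod_nonzero\<close> applies.\<close>
  have "\<exists>\<tau>\<in>upper_half_plane. (\<Prod>p\<in>R \<times> torsion t. torsion_factor (coset_rep (fst p)) (torsion_pt t (snd p)) \<tau>) \<noteq> 0"
  proof (rule holomorphic_prod_nonzero[OF _ open_upper_half_plane connected_upper_half_plane])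
    show "upper_half_plane \<noteq> {}" using \<tau>0 by blast
  next
    fix p assume "p \<in> R \<times> torsion t"
    then show "\<exists>\<tau>\<in>upper_half_plane. torsion_factor (coset_rep (fst p)) (torsion_pt t (snd p)) \<tau> \<noteq> 0"
      using good by (intro torsion_factor_nonzero[OF t _ \<tau>0] rep) (auto simp: t_def)
  qed (use finR in \<open>auto intro!: torsion_factor_holomorphic rep\<close>)
  then show False
    using H0 by (auto simp: H_def prod.cartesian_product case_prod_unfold)
qed

end

section \<open>The numerical condition\<close>

text \<open>Certified by e < 2.72 through ln 13 \<ge> 5/2 and ln (5/2) \<ge> 4/5. The double
  logarithm enters the numerical condition only through this constant.\<close>

lemma ln_ln_13: "ln (ln 13) \<ge> (4 / 5 :: real)"
proof -
  have e: "exp 1 < (272 / 100 :: real)" using e_less_272 by simp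
  have "exp (5 / 2) ^ 2 = exp (1::real) ^ 5" by (simp flip: exp_of_nat_mult)
  also have "\<dots> \<le> (272 / 100) ^ 5" using e by (intro power_mono) auto
  also have "\<dots> \<le> 13 ^ 2" by (simp add: power_divide)
  finally have "exp (5 / 2) \<le> (13 :: real)" by (rule power2_le_imp_le) simp
  then have 1: "ln 13 \<ge> (5 / 2 :: real)" by (subst ln_ge_iff) simp_all
  have "exp (4 / 5) ^ 5 = exp (1::real) ^ 4" by (simp flip: exp_of_nat_mult)
  also have "\<dots> \<le> (272 / 100) ^ 4" using e by (intro power_mono) auto
  also have "\<dots> \<le> (5 / 2) ^ 5" by (simp add: power_divide)
  finally have "exp (4 / 5) \<le> (5 / 2 :: real)" by (rule power_le_imp_le_base[of _ 4, simplified]) simp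
  then have "ln (5 / 2) \<ge> (4 / 5 :: real)" by (subst ln_ge_iff) simp_all
  moreover have "ln (5 / 2) \<le> ln (ln 13 :: real)" using 1 by simp
  ultimately show ?thesis by (rule order_trans)
qed

text \<open>The hypothesis yields N \<ge> 13K/5 and N \<ge> 2Ka/5. The first settles m \<le> N with
  \<delta> = 1/2, where the left side is at least N/8; the second settles m > N, where the left side
  is of size N^(3/2) / sqrt m.\<close>

lemma cutoff_exists:
  fixes k m N i :: real
  assumes k: "k > 0" and m: "m > 0" and i: "i \<ge> 1"
    and N: "N \<ge> k * i / 4 * (2 * pi powr (2/3) * m powr (1/3) * k powr (-1/3) + 13)
           * ln (ln (2 * pi powr (2/3) * m powr (1/3) * k powr (-1/3) + 13))"
  obtains \<delta> where "0 \<le> \<delta>" "\<delta> < 1" "\<delta> * sqrt m \<le> sqrt N"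
    "\<delta> * (sqrt N - \<delta> * sqrt m)\<^sup>2 > k * i / (2 * pi * sqrt 3)"
proof -
  define K where "K = k * i"
  define a where "a = pi powr (2/3) * m powr (1/3) * k powr (-1/3)"
  have Kpos: "K > 0" using k i by (simp add: K_def)
  have Kk: "K \<ge> k" using k i by (simp add: K_def)
  have apos: "a > 0" using k m by (simp add: a_def)
  have "ln 13 > (0::real)" by simp
  then have "ln (ln (2 * a + 13)) \<ge> ln (ln 13)" using apos by simp
  then have L: "ln (ln (2 * a + 13)) \<ge> 4 / 5" using ln_ln_13 by linarith
  have "N \<ge> K / 4 * (2 * a + 13) * ln (ln (2 * a + 13))"
    using N by (simp add: K_def a_def mult.assoc)
  moreover have "K / 4 * (2 * a + 13) * ln (ln (2 * a + 13)) \<ge> K / 4 * (2 * a + 13) * (4 / 5)"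
    using L Kpos apos by (intro mult_left_mono) auto
  ultimately have N': "N \<ge> K * (2 * a + 13) / 5" by simp
  moreover have "K * (2 * a + 13) / 5 = 2 * K * a / 5 + 13 * K / 5" by (simp add: field_simps)
  moreover have "2 * K * a / 5 > 0" using Kpos apos by simp
  ultimately have N1: "N \<ge> 13 * K / 5" and N2: "N \<ge> 2 * K * a / 5"
    using Kpos by linarith+
  have Npos: "N > 0" using N1 Kpos by linarith
  have pi3: "pi > 3" using pi_gt3 .
  have s3: "sqrt 3 > 1" by simp
  show ?thesis
  proof (cases "m \<le> N")
    case True
    have "(sqrt N / 2)\<^sup>2 \<le> (sqrt N - 1 / 2 * sqrt m)\<^sup>2"
      using True m Npos by (intro power_mono) (auto simp: field_simps)
    then have "1 / 2 * (sqrt N - 1 / 2 * sqrt m)\<^sup>2 \<ge> N / 8"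
      using Npos by (simp add: power_divide)
    moreover have "K / (2 * pi * sqrt 3) < N / 8"
    proof -
      have "6 * 1 < 2 * pi * sqrt 3" using pi3 s3 by (intro mult_strict_mono[of 6 "2 * pi"]) auto
      then have "K / (2 * pi * sqrt 3) < K / 6" using Kpos by (intro divide_strict_left_mono) auto
      then show ?thesis using N1 Kpos by simp
    qed
    moreover have "1 / 2 * sqrt m \<le> sqrt N"
    proof -
      have "sqrt m \<le> sqrt N" "0 \<le> sqrt m" using True m by auto
      then show ?thesis by linarith
    qed
    ultimately show ?thesis unfolding K_def by (intro that[of "1 / 2"]) linarith+
  next
    case False
    \<comment> \<open>This value maximises \<delta> (sqrt N - \<delta> sqrt m)^2 on the admissible
      range, the derivative being (sqrt N - \<delta> sqrt m)(sqrt N - 3\<delta> sqrt m).\<close>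
    define \<delta> where "\<delta> = sqrt N / (3 * sqrt m)"
    have \<delta>m: "\<delta> * sqrt m = sqrt N / 3" using m by (simp add: \<delta>_def)
    have \<delta>0: "0 \<le> \<delta>" using m Npos by (simp add: \<delta>_def)
    have "sqrt N < sqrt m" "0 < sqrt m" using False m by auto
    then have "sqrt N < 3 * sqrt m" by linarith
    then have \<delta>1: "\<delta> < 1" using m Npos by (simp add: \<delta>_def divide_less_eq)
    have val: "\<delta> * (sqrt N - \<delta> * sqrt m)\<^sup>2 = \<delta> * (4 * N / 9)"
      unfolding \<delta>m using Npos by (simp add: power2_eq_square field_simps)
    have "(\<delta> * (4 * N / 9))\<^sup>2 = 16 * N ^ 3 / (729 * m)"
    proof -
      have "(\<delta> * (4 * N / 9))\<^sup>2 = (sqrt N)\<^sup>2 * (4 * N)\<^sup>2 / ((3 * 9)\<^sup>2 * (sqrt m)\<^sup>2)"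
        by (simp add: \<delta>_def power_mult_distrib power_divide)
      also have "\<dots> = N * (4 * N)\<^sup>2 / ((3 * 9)\<^sup>2 * m)"
        using m Npos by (simp only: real_sqrt_pow2 less_imp_le)
      also have "\<dots> = 16 * N ^ 3 / (729 * m)" by (simp add: power2_eq_square power3_eq_cube)
      finally show ?thesis .
    qed
    \<comment> \<open>The exponents 1/3 in the hypothesis are made for this: the factor m in the
      cube cancels the m in the denominator of the squared target.\<close>
    have "a ^ 3 = pi\<^sup>2 * m / k"
    proof -
      have cube: "(x powr (c / 3)) ^ 3 = x powr c" if "x > 0" for x c :: real
        using that by (simp add: powr_power)
      have "a ^ 3 = pi powr 2 * m powr 1 * k powr (-1)"
        unfolding a_def power_mult_distrib cube[OF k] cube[OF m] cube[OF pi_gt_zero] ..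
      also have "pi powr 2 = pi\<^sup>2" by (rule powr_numeral) simp
      also have "k powr (-1) = 1 / k" using k by (simp add: powr_minus_divide)
      finally show ?thesis using m by simp
    qed
    have "N ^ 3 \<ge> (2 * K * a / 5) ^ 3"
      using N2 Kpos apos by (intro power_mono) auto
    also have "(2 * K * a / 5) ^ 3 = 8 * K ^ 3 * a ^ 3 / 125"
      by (simp add: power_mult_distrib power_divide)
    finally have N3: "N ^ 3 \<ge> 8 * K ^ 3 * (pi\<^sup>2 * m / k) / 125"
      using \<open>a ^ 3 = _\<close> by simp
    have sq: "(K / (2 * pi * sqrt 3))\<^sup>2 < (\<delta> * (4 * N / 9))\<^sup>2"
    proof -
      \<comment> \<open>Here 91125 = 729 * 125 and 1536 = 12 * 128 clear the denominators; pi > 3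
        suffices, since 1536 * 81 = 124416.\<close>
      have "3 ^ 4 \<le> pi ^ 4" using pi3 by (intro power_mono) auto
      then have "K\<^sup>2 * 91125 < K\<^sup>2 * (1536 * pi ^ 4)"
        using Kpos by (intro mult_strict_left_mono) auto
      then have "K\<^sup>2 / (12 * pi\<^sup>2) < 128 * pi\<^sup>2 / 91125 * K\<^sup>2"
        by (simp add: field_simps power2_eq_square power4_eq_xxxx)
      \<comment> \<open>Index at least 1 gives K \<ge> k, which absorbs the 1/k coming from the cube
        of \<open>a\<close>.\<close>
      also have "\<dots> \<le> 128 * pi\<^sup>2 / 91125 * (K ^ 3 / k)"
      proof (intro mult_left_mono)
        show "K\<^sup>2 \<le> K ^ 3 / k"
          using Kk k Kpos by (simp add: field_simps power2_eq_square power3_eq_cube)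
      qed auto
      also have "\<dots> = 16 / (729 * m) * (8 * K ^ 3 * (pi\<^sup>2 * m / k) / 125)"
        using m by simp
      also have "\<dots> \<le> 16 / (729 * m) * N ^ 3"
        using m by (intro mult_left_mono N3) auto
      also have "\<dots> = (\<delta> * (4 * N / 9))\<^sup>2"
        using \<open>(\<delta> * (4 * N / 9))\<^sup>2 = _\<close> by simp
      finally show ?thesis by (simp add: power_divide power_mult_distrib)
    qed
    then have "K / (2 * pi * sqrt 3) < \<delta> * (4 * N / 9)"
      by (rule power2_less_imp_less) (use \<delta>0 Npos in simp)
    then have "\<delta> * (sqrt N - \<delta> * sqrt m)\<^sup>2 > k * i / (2 * pi * sqrt 3)"
      unfolding val K_def .
    moreover have "\<delta> * sqrt m \<le> sqrt N" unfolding \<delta>m using Npos by simp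
    ultimately show ?thesis by (intro that[of \<delta>] \<delta>0 \<delta>1)
  qed
qed

theorem theorem3p4:
  fixes k m N :: nat and \<Gamma> :: "(int^2^2) set" and chi :: "int^2^2 \<Rightarrow> complex"
  assumes "k > 0" and "m > 0" and "N > 0"
    and "congruence_subgroup \<Gamma>"
    and "finite_order_character \<Gamma> chi"
    and "real N \<ge> real k * real (SL2Z_index \<Gamma>) / 4
           * (2 * pi powr (2/3) * real m powr (1/3) * real k powr (-1/3) + 13)
           * ln (ln (2 * pi powr (2/3) * real m powr (1/3) * real k powr (-1/3) + 13))"
  shows "jacobi_forms_vanishing k m \<Gamma> chi N = {\<lambda>\<tau> z. 0}"
proof (intro equalityI subsetI)
  fix \<phi> :: "complex \<Rightarrow> complex \<Rightarrow> complex" assume "\<phi> \<in> {\<lambda>\<tau> z. 0}"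
  then show "\<phi> \<in> jacobi_forms_vanishing k m \<Gamma> chi N"
    using zero_in_jacobi_forms_vanishing by simp
next
  fix \<phi> assume "\<phi> \<in> jacobi_forms_vanishing k m \<Gamma> chi N"
  then have form: "\<phi> \<in> jacobi_forms k m \<Gamma> chi" and ord: "ord_infty \<phi> \<ge> ereal (real N)"
    by (auto simp: jacobi_forms_vanishing_def)
  interpret jacobi_form k m \<Gamma> chi \<phi>
    using assms form by unfold_locales
  have "real (SL2Z_index \<Gamma>) \<ge> 1" using index_pos by linarith
  then obtain \<delta> where "0 \<le> \<delta>" "\<delta> < 1" "\<delta> * sqrt (real m) \<le> sqrt (real N)"
    "\<delta> * (sqrt (real N) - \<delta> * sqrt (real m))\<^sup>2 > real k * real (SL2Z_index \<Gamma>) / (2 * pi * sqrt 3)"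
    using cutoff_exists[of "real k" "real m" "real (SL2Z_index \<Gamma>)" "real N"] assms by auto
  then have "\<phi> \<tau> z = 0" if "Im \<tau> > 0" for \<tau> z
    using vanishing_criterion[OF assms(2) _ ord] that by auto
  moreover have "\<phi> \<tau> z = 0" if "Im \<tau> \<le> 0" for \<tau> z
    using form that by (simp add: jacobi_forms_def)
  ultimately have "\<phi> = (\<lambda>\<tau> z. 0)"
    by (intro ext) (meson not_le)
  then show "\<phi> \<in> {\<lambda>\<tau> z. 0}" by simp
qed

end
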